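(* For a word $w=x^{a_1}y\,x^{a_2}y\cdots x^{a_L}y$ in noncommuting letters $x,y$ (with $a_1\ge1$, $a_2,\dots,a_L\ge 0$) and $\lambda\in\mathbb{C}\setminus\mathbb{Z}_{\ge1}$, set $$F(w;\lambda)=\sum_{n_1>\dots>n_L>0}\ \prod_{r=1}^{L}\frac{1}{n_r^{a_r}(n_r-\lambda)}.$$ For integers $k_1,l_1,\dots,k_m,l_m\ge 0$ with $k_1,l_m\ge1$ set $f(\{k_i,l_i\}_{i=1}^m;\lambda)=F(x^{k_1}y^{l_1}x^{k_2}y^{l_2}\cdots x^{k_m}y^{l_m};\lambda)$ and $g(\{k_i,l_i\}_{i=1}^m;\lambda)=F(x^{l_m}y^{k_m}x^{l_{m-1}}y^{k_{m-1}}\cdots x^{l_1}y^{k_1};\lambda)$. Let $I=\{(0,0),(1,0),(0,1)\}$, $\lambda'=\lambda-1$, and for a family of indices $\delta_i,\epsilon_i$ write $|\delta|=\sum\delta_i$, $|\epsilon|=\sum\epsilon_i$ (likewise $|\delta'|,|\epsilon'|$). Let $m\ge1$ and $k_1,l_1,\dots,k_m,l_m\in\mathbb{Z}_{\ge1}$. Then, for all $\lambda\in\mathbb{C}\setminus\mathbb{Z}_{\ge1}$: (i) If $k_1\ne1$ and $l_m\ne1$: $$\sum_{\{(\delta_i,\epsilon_i)\}_{i=1}^m\in I^m}(-\lambda)^{m-|\delta|-|\epsilon|}f(\{k_i-\delta_i,l_i-\epsilon_i\}_{i=1}^m;\lambda)=\sum_{\delta_1'\in\{0,1\}}\ \sum_{\{(\delta_j',\epsilon_j')\}_{j=2}^m\in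 I^{m-1}}\ \sum_{\epsilon_{m+1}'\in\{0,1\}}(-\lambda')^{m-|\delta'|-|\epsilon'|}f(\{k_i-\delta_i',l_i-\epsilon_{i+1}'\}_{i=1}^m;\lambda').$$ (ii) If $k_1=1$ and $l_m\ne1$: $$\sum_{\epsilon_1\in\{0,1\}}\ \sum_{\{(\delta_i,\epsilon_i)\}_{i=2}^m\in I^{m-1}}(-\lambda)^{m-|\delta|-|\epsilon|}f(\{1,l_1-\epsilon_1\}\cup\{k_i-\delta_i,l_i-\epsilon_i\}_{i=2}^m;\lambda)=\sum_{\{(\delta_j',\epsilon_j')\}_{j=2}^m\in I^{m-1}}\ \sum_{\epsilon_{m+1}'\in\{0,1\}}(-\lambda')^{m-|\delta'|-|\epsilon'|}f(\{1,l_1-\epsilon_2'\}\cup\{k_i-\delta_i',l_i-\epsilon_{i+1}'\}_{i=2}^m;\lambda').$$ (iii) If $k_1\ne1$ and $l_m=1$: $$\sum_{\{(\delta_i,\epsilon_i)\}_{i=1}^{m-1}\in I^{m-1}}\ \sum_{\delta_m\in\{0,1\}}(-\lambda)^{m-|\delta|-|\epsilon|}f(\{k_i-\delta_i,l_i-\epsilon_i\}_{i=1}^{m-1}\cup\{k_m-\delta_m,1\};\lambda)=\sum_{\delta_1'\in\{0,1\}}\ \sum_{\{(\delta_j',\epsilon_j')\}_{j=2}^m\in I^{m-1}}(-\lambda')^{m-|\delta'|-|\epsilon'|}f(\{k_i-\delta_i',l_i-\epsilon_{i+1}'\}_{i=1}^{m-1}\cup\{k_m-\delta_m',1\};\lambda').$$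 (iv) If $k_1=l_m=1$ and $m\ge2$: $$\sum_{\epsilon_1\in\{0,1\}}\ \sum_{\{(\delta_i,\epsilon_i)\}_{i=2}^{m-1}\in I^{m-2}}\ \sum_{\delta_m\in\{0,1\}}(-\lambda)^{m-|\delta|-|\epsilon|}f(\{1,l_1-\epsilon_1\}\cup\{k_i-\delta_i,l_i-\epsilon_i\}_{i=2}^{m-1}\cup\{k_m-\delta_m,1\};\lambda)=\sum_{\{(\delta_j',\epsilon_j')\}_{j=2}^m\in I^{m-1}}(-\lambda')^{m-|\delta'|-|\epsilon'|}f(\{1,l_1-\epsilon_2'\}\cup\{k_i-\delta_i',l_i-\epsilon_{i+1}'\}_{i=2}^{m-1}\cup\{k_m-\delta_m',1\};\lambda').$$ Moreover the same four identities hold with $f$ replaced by $g$ throughout.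
   Context: Here $\{a_1,b_1\}\cup\{a_i,b_i\}_{i=2}^m$ denotes the sequence $(a_1,b_1,a_2,b_2,\dots,a_m,b_m)$, and in each sum the exponents $|\delta|,|\epsilon|$ (resp. $|\delta'|,|\epsilon'|$) are the sums of all the $\delta_i,\epsilon_i$ (resp. $\delta_i',\epsilon_i'$) occurring as summation variables in that sum. Since $x^ay^0x^b=x^{a+b}$ and $y^ax^0y^b=y^{a+b}$, entries equal to $0$ are allowed in $f,g$. Equivalently, $f(\{k_i,l_i\};\lambda)=\sum_{n_1>\dots>n_{L_m}>0}\prod_{i=1}^m\big(n_{L_{i-1}+1}^{k_i}\prod_{r=L_{i-1}+1}^{L_i}(n_r-\lambda)\big)^{-1}$ with $L_i=l_1+\dots+l_i$; these are generating functions in $\lambda$ of sums of multiple zeta values of fixed index with total weight increased by the power of $\lambda$, and $g$ corresponds to the dual index. *)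

theory Defs
  imports "HOL-Analysis.Analysis" "HOL-Library.FuncSet"
begin

datatype letter = LX | LY

text \<open>For a word x^(a_1) y x^(a_2) y ... x^(a_L) y, the exponent list [a_1,...,a_L]
  (the number of x's preceding each y).  Here c counts the x's read so far.\<close>
fun yexps :: "nat \<Rightarrow> letter list \<Rightarrow> nat list" where
  "yexps c [] = []"
| "yexps c (LX # w) = yexps (Suc c) w"
| "yexps c (LY # w) = c # yexps 0 w"

definition Fsum :: "nat list \<Rightarrow> complex \<Rightarrow> complex" where
  "Fsum a lam = infsum
     (\<lambda>ns. \<Prod>r<length a. 1 / (of_nat (ns ! r) ^ (a ! r) * (of_nat (ns ! r) - lam)))
     {ns. length ns = length a \<and> sorted_wrt (>) ns \<and> (\<forall>n\<in>set ns. 0 < n)}"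

definition Fword :: "letter list \<Rightarrow> complex \<Rightarrow> complex" where
  "Fword w lam = Fsum (yexps 0 w) lam"

definition fword :: "nat \<Rightarrow> (nat \<Rightarrow> nat) \<Rightarrow> (nat \<Rightarrow> nat) \<Rightarrow> letter list" where
  "fword m k l = concat (map (\<lambda>i. replicate (k i) LX @ replicate (l i) LY) [1..<m+1])"

definition gword :: "nat \<Rightarrow> (nat \<Rightarrow> nat) \<Rightarrow> (nat \<Rightarrow> nat) \<Rightarrow> letter list" where
  "gword m k l = concat (map (\<lambda>i. replicate (l i) LX @ replicate (k i) LY) (rev [1..<m+1]))"

definition ff :: "nat \<Rightarrow> (nat \<Rightarrow> nat) \<Rightarrow> (nat \<Rightarrow> nat) \<Rightarrow> complex \<Rightarrow> complex" where
  "ff m k l lam = Fword (fword m k l) lam"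

definition gg :: "nat \<Rightarrow> (nat \<Rightarrow> nat) \<Rightarrow> (nat \<Rightarrow> nat) \<Rightarrow> complex \<Rightarrow> complex" where
  "gg m k l lam = Fword (gword m k l) lam"

definition Ipairs :: "(nat \<times> nat) set" where
  "Ipairs = {(0,0),(1,0),(0,1)}"

definition lhs_sum :: "(nat \<Rightarrow> (nat \<Rightarrow> nat) \<Rightarrow> (nat \<Rightarrow> nat) \<Rightarrow> complex \<Rightarrow> complex)
    \<Rightarrow> nat \<Rightarrow> (nat \<Rightarrow> nat) \<Rightarrow> (nat \<Rightarrow> nat) \<Rightarrow> (nat \<Rightarrow> (nat \<times> nat) set) \<Rightarrow> complex \<Rightarrow> complex" where
  "lhs_sum h m k l A lam =
     (\<Sum>d\<in>PiE {1..m} A.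
        (- lam) powi (int m - int (\<Sum>i\<in>{1..m}. fst (d i)) - int (\<Sum>i\<in>{1..m}. snd (d i)))
        * h m (\<lambda>i. k i - fst (d i)) (\<lambda>i. l i - snd (d i)) lam)"

text \<open>Right-hand sides: sum over families p j = (delta'_j, epsilon'_j), j = 1..m+1, with
  p j ranging over B j (delta'_(m+1) and epsilon'_1 are always 0, i.e. absent), of
  (-lambda')^(m-|delta'|-|epsilon'|) h({k_i-delta'_i, l_i-epsilon'_(i+1)}; lambda'),
  lambda' = lambda - 1.\<close>
definition rhs_sum :: "(nat \<Rightarrow> (nat \<Rightarrow> nat) \<Rightarrow> (nat \<Rightarrow> nat) \<Rightarrow> complex \<Rightarrow> complex)
    \<Rightarrow> nat \<Rightarrow> (nat \<Rightarrow> nat) \<Rightarrow> (nat \<Rightarrow> nat) \<Rightarrow> (nat \<Rightarrow> (nat \<times> nat) set) \<Rightarrow> complex \<Rightarrow> complex" where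
  "rhs_sum h m k l B lam =
     (\<Sum>p\<in>PiE {1..m+1} B.
        (- (lam - 1)) powi (int m - int (\<Sum>j\<in>{1..m+1}. fst (p j)) - int (\<Sum>j\<in>{1..m+1}. snd (p j)))
        * h m (\<lambda>i. k i - fst (p i)) (\<lambda>i. l i - snd (p (i + 1))) (lam - 1))"

end

theory Submission
  imports Defs
begin

text \<open>
  Encode a word by the density \<open>D(n)\<close> of its nested sum, i.e. the part of the sum with \<open>n_1 = n\<close>.
  Prepending x divides the density by n, and prepending y replaces it by \<open>(\<Sum>p<n. D p) / (n - lam)\<close>;
  the empty word is the unit mass at 0.  Each side of the identity is then the total mass of a product of
  operators, one three-term factor per summation pair.  Write S for the summation \<open>\<Sum>p\<le>n\<close>.  On the left
  the factor for block i collapses to \<open>x^(k_i) S y^(l_i - 1)\<close>, because \<open>1 - lam/n\<close> cancels one pole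
  \<open>n - lam\<close> and the term with \<open>l_i - 1\<close> supplies the diagonal.  On the right the same
  cancellation yields \<open>S\<close> after the poles \<open>n - lam'\<close>, and both sides agree by the commutation rule
  \<open>S y_lam = (\<Sum>p<n. _ / (p - lam')) S\<close>, which is the index shift \<open>p \<mapsto> p - 1\<close>.

  If \<open>k_1 = 1\<close> the two densities differ by \<open>E(n) - E(n + 1)\<close> with \<open>E\<close> tending to 0.  The case of g reduces
  to that of f by reversing the block sequence and exchanging the roles of k and l.
\<close>

subsection \<open>Words as operators on densities\<close>

text \<open>Division by 0 yields 0, so x kills any mass at n = 0, as nested sums over positive
  integers require.\<close>

definition xop :: "(nat \<Rightarrow> complex) \<Rightarrow> nat \<Rightarrow> complex" where
  "xop h n = h n / of_nat n"

definition yop :: "complex \<Rightarrow> (nat \<Rightarrow> complex) \<Rightarrow> nat \<Rightarrow> complex" where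
  "yop lam h n = (\<Sum>p<n. h p) / (of_nat n - lam)"

definition ssum :: "(nat \<Rightarrow> complex) \<Rightarrow> nat \<Rightarrow> complex" where
  "ssum h n = (\<Sum>p\<le>n. h p)"

definition delta0 :: "nat \<Rightarrow> complex" where
  "delta0 n = (if n = 0 then 1 else 0)"

primrec letter_op :: "complex \<Rightarrow> letter \<Rightarrow> (nat \<Rightarrow> complex) \<Rightarrow> nat \<Rightarrow> complex" where
  "letter_op lam LX = xop"
| "letter_op lam LY = yop lam"

definition word_op :: "complex \<Rightarrow> letter list \<Rightarrow> (nat \<Rightarrow> complex) \<Rightarrow> nat \<Rightarrow> complex" where
  "word_op lam w = foldr (letter_op lam) w"

lemma word_op_Nil [simp]: "word_op lam [] h = h"
  and word_op_Cons [simp]: "word_op lam (a # w) h = letter_op lam a (word_op lam w h)"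
  and word_op_append [simp]: "word_op lam (v @ w) h = word_op lam v (word_op lam w h)"
  and word_op_replicate_LX [simp]: "word_op lam (replicate r LX) h = (xop ^^ r) h"
  and word_op_replicate_LY [simp]: "word_op lam (replicate r LY) h = (yop lam ^^ r) h"
  by (simp_all add: word_op_def foldr_replicate)

lemma xop_funpow: "(xop ^^ r) h n = h n / of_nat n ^ r"
  by (induction r) (auto simp: xop_def)

lemma yop_0 [simp]: "yop lam h 0 = 0"
  by (simp add: yop_def)

lemma yop_funpow_0: "h 0 = 0 \<or> r > 0 \<Longrightarrow> (yop lam ^^ r) h 0 = 0"
  by (cases r) auto

lemma ssum_0 [simp]: "ssum h 0 = h 0"
  by (simp add: ssum_def)

lemma ssum_delta0 [simp]: "ssum delta0 n = 1"
  by (simp add: ssum_def delta0_def)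

lemma ssum_eq: "ssum h n = (\<Sum>p<n. h p) + h n"
  by (simp add: ssum_def flip: lessThan_Suc_atMost)

lemma xop_lin: "xop (\<lambda>n. a * f n + b * g n) = (\<lambda>n. a * xop f n + b * xop g n)"
  by (rule ext) (simp add: xop_def add_divide_distrib)

lemma yop_lin: "yop lam (\<lambda>n. a * f n + b * g n) = (\<lambda>n. a * yop lam f n + b * yop lam g n)"
  by (rule ext) (simp add: yop_def add_divide_distrib sum.distrib sum_distrib_left)

lemma yop_funpow_lin:
  "(yop lam ^^ r) (\<lambda>n. a * f n + b * g n) = (\<lambda>n. a * (yop lam ^^ r) f n + b * (yop lam ^^ r) g n)"
  by (induction r) (simp_all add: yop_lin)

lemma word_op_lin:
  "word_op lam w (\<lambda>n. a * f n + b * g n) = (\<lambda>n. a * word_op lam w f n + b * word_op lam w g n)"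
proof (induction w)
  case (Cons x w)
  then show ?case by (cases x) (simp_all add: xop_lin yop_lin)
qed simp

lemma word_op_zero: "word_op lam w (\<lambda>n. 0) = (\<lambda>n. 0)"
  using word_op_lin[of lam w 0 "\<lambda>n. 0" 0 "\<lambda>n. 0"] by simp

lemma word_op_sum:
  assumes "finite S"
  shows "word_op lam w (\<lambda>n. \<Sum>s\<in>S. c s * g s n) = (\<lambda>n. \<Sum>s\<in>S. c s * word_op lam w (g s) n)"
  using assms
proof (induction S)
  case (insert s S)
  then show ?case
    using word_op_lin[of lam w "c s" "g s" 1 "\<lambda>n. \<Sum>s\<in>S. c s * g s n"] by simp
qed (simp add: word_op_zero)

text \<open>Expansion of a product of sums: linearity of \<open>word_op\<close> turns the sum over
  all families into a composition of one operator per index. The induction splits off the value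
  chosen at \<open>a\<close>.\<close>

lemma sum_PiE_word_op:
  assumes "\<And>i. finite (A i)"
  shows "(\<lambda>n. \<Sum>d\<in>PiE {a..<b} A. (\<Prod>i\<in>{a..<b}. c i (d i)) *
            word_op lam (concat (map (\<lambda>i. W i (d i)) [a..<b])) g n) =
         foldr (\<lambda>i h n. \<Sum>e\<in>A i. c i e * word_op lam (W i e) h n) [a..<b] g"
proof (induction "b - a" arbitrary: a)
  case 0
  then show ?case by simp
next
  case (Suc r)
  then have ab: "a < b" and r: "r = b - Suc a" by auto
  have fin: "finite (PiE {Suc a..<b} A)"
    using assms by (intro finite_PiE) auto
  let ?t = "\<lambda>d n. (\<Prod>i\<in>{Suc a..<b}. c i (d i)) *
            word_op lam (concat (map (\<lambda>i. W i (d i)) [Suc a..<b])) g n"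
  have cong: "(\<Prod>i\<in>{a..<b}. c i ((d(a := e)) i)) * word_op lam (concat (map (\<lambda>i. W i ((d(a := e)) i)) [a..<b])) g n =
    c a e * ((\<Prod>i\<in>{Suc a..<b}. c i (d i)) * word_op lam (W a e) (word_op lam (concat (map (\<lambda>i. W i (d i)) [Suc a..<b])) g) n)"
    for d e n
  proof -
    have "map (\<lambda>i. W i ((d(a := e)) i)) [Suc a..<b] = map (\<lambda>i. W i (d i)) [Suc a..<b]"
      by (rule map_cong) auto
    moreover have "(\<Prod>i\<in>{Suc a..<b}. c i ((d(a := e)) i)) = (\<Prod>i\<in>{Suc a..<b}. c i (d i))"
      by (rule prod.cong) auto
    ultimately show ?thesis
      using ab by (simp add: upt_conv_Cons prod.atLeast_Suc_lessThan fun_upd_same del: fun_upd_apply map_eq_conv)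
  qed
  \<comment> \<open>A family on \<open>{a..<b}\<close> is a value e at \<open>a\<close> together
    with a family d on the rest, through \<open>d(a := e)\<close>.\<close>
  have "{a..<b} = insert a {Suc a..<b}"
    using ab by auto
  then have "(\<Sum>d\<in>PiE {a..<b} A. (\<Prod>i\<in>{a..<b}. c i (d i)) *
            word_op lam (concat (map (\<lambda>i. W i (d i)) [a..<b])) g n) =
    (\<Sum>(e, d)\<in>A a \<times> PiE {Suc a..<b} A. (\<Prod>i\<in>{a..<b}. c i ((d(a := e)) i)) * word_op lam (concat (map (\<lambda>i. W i ((d(a := e)) i)) [a..<b])) g n)" for n
    by (simp only: PiE_insert_eq) (subst sum.reindex[OF inj_combinator], simp_all add: case_prod_unfold)
  also have "\<dots> n = (\<Sum>e\<in>A a. c a e * word_op lam (W a e) (\<lambda>n. \<Sum>d\<in>PiE {Suc a..<b} A. ?t d n) n)" for n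
    by (simp only: cong word_op_sum[OF fin] sum.cartesian_product[symmetric] sum_distrib_left)
  also have "\<dots> n = foldr (\<lambda>i h n. \<Sum>e\<in>A i. c i e * word_op lam (W i e) h n) [a..<b] g n" for n
    using ab Suc.hyps(1)[OF r] by (simp add: upt_conv_Cons)
  finally show ?case by (rule ext)
qed

text \<open>Since p - mu = (p + 1) - lam and \<open>ssum g p\<close> runs over q < p + 1, the
  quotient \<open>ssum g p / (p - mu)\<close> is \<open>yop lam g (p + 1)\<close>. Summing over p <
  n gives \<open>ssum (yop lam g) n\<close>, because \<open>yop lam g 0 = 0\<close>.\<close>

lemma yop_shift:
  assumes "mu = lam - 1"
  shows "(yop mu ^^ r) (\<lambda>n. ssum h n / (of_nat n - mu)) =
         (\<lambda>n. ssum ((yop lam ^^ r) h) n / (of_nat n - mu))"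
proof (induction r)
  case (Suc r)
  have "(\<Sum>p<n. ssum g p / (of_nat p - mu)) = ssum (yop lam g) n" for g n
    by (induction n) (simp_all add: ssum_def yop_def assms algebra_simps flip: lessThan_Suc_atMost)
  with Suc show ?case by (simp add: yop_def[of mu])
qed simp

subsection \<open>Convergence of the nested sums\<close>

text \<open>The coefficient type is general so that one recursion serves both the complex terms and
  their real norms.\<close>

fun nested :: "(nat \<Rightarrow> 'a::comm_semiring_1) list \<Rightarrow> nat \<Rightarrow> 'a" where
  "nested [] N = 1"
| "nested (f # fs) N = (\<Sum>n\<in>{1..<N}. f n * nested fs n)"

definition dec_lists :: "nat \<Rightarrow> nat \<Rightarrow> nat list set" where
  "dec_lists L N = {ns. length ns = L \<and> sorted_wrt (>) ns \<and> (\<forall>n\<in>set ns. 0 < n \<and> n < N)}"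

lemma dec_lists_0: "dec_lists 0 N = {[]}"
  by (auto simp: dec_lists_def)

lemma dec_lists_Suc: "dec_lists (Suc L) N = (\<lambda>(n, ns). n # ns) ` (SIGMA n:{1..<N}. dec_lists L n)"
  by (auto simp: dec_lists_def length_Suc_conv image_iff Suc_le_eq) (metis order.strict_trans)+

lemma finite_dec_lists: "finite (dec_lists L N)"
  by (induction L arbitrary: N) (auto simp: dec_lists_0 dec_lists_Suc)

lemma sum_dec_lists:
  "(\<Sum>ns\<in>dec_lists (length fs) N. \<Prod>r<length fs. (fs ! r) (ns ! r)) = nested fs N"
proof (induction fs arbitrary: N)
  case (Cons f fs)
  have "inj_on (\<lambda>(n, ns). n # ns) (SIGMA n:{1..<N}. dec_lists (length fs) n)"
    by (auto simp: inj_on_def)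
  then have "(\<Sum>ns\<in>dec_lists (length (f # fs)) N. \<Prod>r<length (f # fs). ((f # fs) ! r) (ns ! r)) =
    (\<Sum>(n, ns)\<in>(SIGMA n:{1..<N}. dec_lists (length fs) n). f n * (\<Prod>r<length fs. (fs ! r) (ns ! r)))"
    by (simp add: dec_lists_Suc sum.reindex case_prod_unfold prod.lessThan_Suc_shift del: prod.lessThan_Suc)
  also have "\<dots> = nested (f # fs) N"
    by (simp add: sum.Sigma[symmetric] finite_dec_lists sum_distrib_left[symmetric] Cons)
  finally show ?case .
qed (simp add: dec_lists_0)

text \<open>Telescoping: consecutive square roots s, t satisfy (t - s)(t + s) = 1 and t + s \<le>
  2t, hence 1/t \<le> 2(t - s).\<close>

lemma sum_inverse_sqrt_le: "(\<Sum>p\<in>{1..<n}. 1 / sqrt (real p)) \<le> 2 * sqrt (real n)"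
proof -
  have "(\<Sum>p=1..n. 1 / sqrt (real p)) \<le> 2 * sqrt (real n)"
  proof (induction n)
    case (Suc n)
    define s t where "s = sqrt (real n)" and "t = sqrt (real (Suc n))"
    have "t > 0" "s \<le> t" "(t - s) * (t + s) = 1"
      by (simp_all add: s_def t_def algebra_simps)
    moreover from this have "(t - s) * (t + s) \<le> (t - s) * (2 * t)"
      by (intro mult_left_mono) auto
    ultimately have "1 / t \<le> 2 * (t - s)"
      by (simp add: field_simps)
    with Suc show ?case
      by (simp add: s_def t_def)
  qed simp
  moreover have "(\<Sum>p\<in>{1..<n}. 1 / sqrt (real p)) \<le> (\<Sum>p=1..n. 1 / sqrt (real p))"
    by (rule sum_mono2) auto
  ultimately show ?thesis by linarith
qed

lemma bounded_sum_sqrt_div_square: "\<exists>C. \<forall>n. (\<Sum>p\<in>{1..<n}. sqrt (real p) / (real p)\<^sup>2) \<le> C"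
proof -
  have "summable (\<lambda>p. real p powr (- 3/2))"
    by (subst summable_real_powr_iff) simp
  moreover have "real p powr (- 3/2) = sqrt (real p) / (real p)\<^sup>2" for p
  proof (cases "p = 0")
    case False
    then have "sqrt (real p) / (real p)\<^sup>2 = real p powr (1/2) / real p powr 2"
      by (simp add: powr_half_sqrt)
    also have "\<dots> = real p powr (1/2 - 2)"
      by (rule powr_diff[symmetric])
    finally show ?thesis by simp
  qed simp
  ultimately have *: "summable (\<lambda>p. sqrt (real p) / (real p)\<^sup>2)"
    by simp
  have "(\<Sum>p\<in>{1..<n}. sqrt (real p) / (real p)\<^sup>2) \<le> (\<Sum>p. sqrt (real p) / (real p)\<^sup>2)" for n
    by (rule sum_le_suminf[OF *]) auto
  then show ?thesis by blast
qed

text \<open>Growth of order sqrt n reproduces itself: multiplying by c/p leaves a sum of 1/sqrt p,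
  which is again of order sqrt n.\<close>

lemma nested_le_sqrt:
  fixes fs :: "(nat \<Rightarrow> real) list"
  assumes "\<forall>f\<in>set fs. \<forall>n\<ge>1. 0 \<le> f n \<and> f n \<le> c / n"
  shows "\<exists>C\<ge>0. \<forall>n\<ge>1. 0 \<le> nested fs n \<and> nested fs n \<le> C * sqrt n"
  using assms
proof (induction fs)
  case Nil
  show ?case by (auto intro!: exI[of _ 1])
next
  case (Cons f fs)
  then obtain C where C: "C \<ge> 0" "\<And>n. n \<ge> 1 \<Longrightarrow> 0 \<le> nested fs n \<and> nested fs n \<le> C * sqrt n"
    by auto
  have f: "0 \<le> f n" "f n \<le> c / n" if "n \<ge> 1" for n
    using Cons.prems that by auto
  have c: "c \<ge> 0"
    using f[of 1] by simp
  have "nested (f # fs) n \<le> (2 * (c * C)) * sqrt n" for n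
  proof -
    have "nested (f # fs) n \<le> (\<Sum>p\<in>{1..<n}. c / p * (C * sqrt p))"
      unfolding nested.simps by (intro sum_mono mult_mono) (use f C c in auto)
    also have "\<dots> = c * C * (\<Sum>p\<in>{1..<n}. 1 / sqrt p)"
      unfolding sum_distrib_left by (intro sum.cong refl) (simp add: field_simps)
    also have "\<dots> \<le> c * C * (2 * sqrt n)"
      using c C by (intro mult_left_mono sum_inverse_sqrt_le) auto
    finally show ?thesis by simp
  qed
  moreover have "0 \<le> nested (f # fs) n" for n
    using f C by (auto intro!: sum_nonneg mult_nonneg_nonneg)
  moreover have "2 * (c * C) \<ge> 0"
    using c C by simp
  ultimately show ?case by blast
qed

text \<open>An outermost factor of order 1/n^2 against inner growth sqrt n leaves the convergent
  series of n powr (-3/2).\<close>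

lemma nested_bounded:
  fixes fs :: "(nat \<Rightarrow> real) list"
  assumes "\<forall>n\<ge>1. 0 \<le> f n \<and> f n \<le> c / (real n)\<^sup>2"
    and "\<forall>f\<in>set fs. \<forall>n\<ge>1. 0 \<le> f n \<and> f n \<le> c / n"
  shows "\<exists>C. \<forall>n. nested (f # fs) n \<le> C"
proof -
  obtain C where C: "C \<ge> 0" "\<And>n. n \<ge> 1 \<Longrightarrow> 0 \<le> nested fs n \<and> nested fs n \<le> C * sqrt n"
    using nested_le_sqrt[OF assms(2)] by auto
  obtain B where B: "\<And>n. (\<Sum>p\<in>{1..<n}. sqrt (real p) / (real p)\<^sup>2) \<le> B"
    using bounded_sum_sqrt_div_square by blast
  have f: "0 \<le> f n" "f n \<le> c / (real n)\<^sup>2" if "n \<ge> 1" for n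
    using assms that by auto
  have c: "c \<ge> 0"
    using f[of 1] by simp
  have "nested (f # fs) n \<le> c * C * B" for n
  proof -
    have "nested (f # fs) n \<le> (\<Sum>p\<in>{1..<n}. c / (real p)\<^sup>2 * (C * sqrt p))"
      unfolding nested.simps by (intro sum_mono mult_mono) (use f C c in auto)
    also have "\<dots> = c * C * (\<Sum>p\<in>{1..<n}. sqrt p / (real p)\<^sup>2)"
      by (simp add: sum_distrib_left mult.assoc)
    also have "\<dots> \<le> c * C * B"
      using c C by (intro mult_left_mono B) auto
    finally show ?thesis .
  qed
  then show ?thesis by blast
qed

definition phi :: "complex \<Rightarrow> nat \<Rightarrow> nat \<Rightarrow> complex" where
  "phi lam a n = 1 / (of_nat n ^ a * (of_nat n - lam))"

text \<open>The counter c of \<open>yexps\<close> counts the x's already read that still wait for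
  their y; they act as the factor 1/n^c. The empty word is allowed only with nothing
  pending.\<close>

lemma nested_word_op:
  assumes "w = [] \<and> c = 0 \<or> w \<noteq> [] \<and> last w = LY" and "N \<ge> 1"
  shows "nested (map (phi lam) (yexps c w)) N = (\<Sum>n<N. word_op lam w delta0 n / of_nat n ^ c)"
  using assms
proof (induction w arbitrary: c N)
  case Nil
  then show ?case by (simp add: delta0_def)
next
  case (Cons a w)
  show ?case
  proof (cases a)
    case LX
    then have "w \<noteq> [] \<and> last w = LY"
      using Cons.prems by (auto split: if_splits)
    then show ?thesis
      using Cons.IH[of "Suc c" N] Cons.prems LX by (simp add: xop_def)
  next
    case LY
    then have w: "w = [] \<or> w \<noteq> [] \<and> last w = LY"
      using Cons.prems by (auto split: if_splits)
    have IH: "nested (map (phi lam) (yexps 0 w)) n = (\<Sum>p<n. word_op lam w delta0 p)" if "n \<ge> 1" for n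
      using Cons.IH[of 0 n] w that by auto
    have "{..<N} = insert 0 {1..<N}"
      using Cons.prems by auto
    then have "(\<Sum>n<N. word_op lam (a # w) delta0 n / of_nat n ^ c) =
      (\<Sum>n\<in>{1..<N}. word_op lam (a # w) delta0 n / of_nat n ^ c)"
      using LY by simp
    also have "\<dots> = (\<Sum>n\<in>{1..<N}. phi lam c n * nested (map (phi lam) (yexps 0 w)) n)"
      using LY by (intro sum.cong refl) (simp add: IH yop_def phi_def mult.commute)
    finally show ?thesis
      using LY by simp
  qed
qed

text \<open>For n \<ge> 2|lam| one has |n - lam| \<ge> n/2, so n/(n - lam) is eventually at most 2
  in norm, and finitely many exceptions are absorbed into K.\<close>

lemma inverse_diff_bound:
  obtains K where "K > 0" "\<And>n. n \<ge> 1 \<Longrightarrow> norm (1 / (of_nat n - lam :: complex)) \<le> K / real n"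
proof -
  obtain M :: nat where M: "2 * norm lam \<le> M" "M \<ge> 1"
    by (metis real_arch_simple max.cobounded1 max.cobounded2 of_nat_mono order_trans)
  have "Bseq (\<lambda>n. of_nat n / (of_nat n - lam))"
  proof (rule BfunI[of _ 2])
    show "\<forall>\<^sub>F n in sequentially. norm (of_nat n / (of_nat n - lam)) \<le> 2"
      using eventually_ge_at_top[of M]
    proof eventually_elim
      case (elim n)
      then have "2 * norm lam \<le> n"
        using M by linarith
      then have "real n \<le> 2 * norm (of_nat n - lam)"
        using norm_triangle_ineq2[of "of_nat n" lam] by simp
      moreover have "real n > 0"
        using elim M(2) by linarith
      moreover have "norm (of_nat n - lam) > 0"
        using calculation by linarith
      ultimately show ?case
        by (simp add: norm_divide divide_simps)
    qed
  qed
  then obtain K where K: "K > 0" "\<And>n. norm (of_nat n / (of_nat n - lam)) \<le> K"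
    by (auto elim: BseqE)
  show thesis
  proof (rule that[OF K(1)])
    fix n :: nat assume "n \<ge> 1"
    then show "norm (1 / (of_nat n - lam)) \<le> K / real n"
      using K(2)[of n] by (simp add: norm_divide field_simps)
  qed
qed

lemma phi_bound:
  assumes "K > 0" "\<And>n. n \<ge> 1 \<Longrightarrow> norm (1 / (of_nat n - lam :: complex)) \<le> K / real n" "n \<ge> 1"
  shows "norm (phi lam a n) \<le> K / real n ^ Suc a"
proof -
  have "norm (phi lam a n) = norm (1 / (of_nat n - lam)) / real n ^ a"
    by (simp add: phi_def norm_divide norm_mult norm_power)
  also have "\<dots> \<le> K / real n / real n ^ a"
    using assms by (intro divide_right_mono) auto
  finally show ?thesis by (simp add: field_simps)
qed

text \<open>Applied with c = 1, this turns a leading x into a_1 \<ge> 1, the extra 1/n that makes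
  the outermost sum converge.\<close>

lemma yexps_first_ge:
  assumes "w \<noteq> []" "last w = LY"
  shows "\<exists>a as. yexps c w = a # as \<and> a \<ge> c"
  using assms
proof (induction w arbitrary: c)
  case (Cons x w)
  show ?case
  proof (cases x)
    case LX
    then obtain a as where "yexps (Suc c) w = a # as" "Suc c \<le> a"
      using Cons.IH[of "Suc c"] Cons.prems by (auto split: if_splits)
    then show ?thesis
      using LX by auto
  qed simp
qed simp

text \<open>\<open>Fsum\<close> is an unordered sum over lists, while the density is summed by the
  largest entry n_1. Absolute convergence, from a uniform bound on truncated sums of norms, makes
  the two agree.\<close>

lemma Fword_tendsto:
  assumes "w \<noteq> []" "last w = LY" "hd w = LX"
  shows "(\<lambda>N. \<Sum>n<N. word_op lam w delta0 n) \<longlonglongrightarrow> Fword w lam"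
proof -
  obtain K where K: "K > 0" "\<And>n. n \<ge> 1 \<Longrightarrow> norm (1 / (of_nat n - lam)) \<le> K / real n"
    using inverse_diff_bound by blast
  obtain v where v: "w = LX # v" "v \<noteq> []" "last v = LY"
    using assms by (cases w) (auto split: if_splits)
  obtain a as where a: "yexps 0 w = a # as" "a \<ge> 1"
    using yexps_first_ge[of v 1] v by auto
  let ?fs = "map (phi lam) (yexps 0 w)"
  let ?L = "length (yexps 0 w)"
  define A where "A = {ns :: nat list. length ns = ?L \<and> sorted_wrt (>) ns \<and> (\<forall>n\<in>set ns. 0 < n)}"
  define f where "f ns = (\<Prod>r<?L. 1 / (of_nat (ns ! r) ^ (yexps 0 w ! r) * (of_nat (ns ! r) - lam)))" for ns :: "nat list"
  have f_eq: "f ns = (\<Prod>r<length ?fs. (?fs ! r) (ns ! r))" for ns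
    by (simp add: f_def phi_def)
  have norm_f_eq: "norm (f ns) = (\<Prod>r<length ?fs. (map (\<lambda>f n. norm (f n)) ?fs ! r) (ns ! r))" for ns
    by (simp add: f_eq prod_norm)
  have sum_f: "(\<Sum>ns\<in>dec_lists ?L N. f ns) = nested ?fs N" for N
    using sum_dec_lists[of ?fs N] by (simp add: f_eq)
  have sum_norm_f: "(\<Sum>ns\<in>dec_lists ?L N. norm (f ns)) = nested (map (\<lambda>f n. norm (f n)) ?fs) N" for N
    using sum_dec_lists[of "map (\<lambda>f n. norm (f n)) ?fs" N] by (simp add: norm_f_eq)
  have exh: "\<exists>N. X \<subseteq> dec_lists ?L N" if "finite X" "X \<subseteq> A" for X
  proof (intro exI subsetI)
    fix ns assume ns: "ns \<in> X"
    have "finite (\<Union>(set ` X))"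
      using that by auto
    then have "n < Suc (Max (\<Union>(set ` X)))" if "n \<in> set ns" for n
      using that ns by (auto intro!: le_imp_less_Suc Max_ge)
    then show "ns \<in> dec_lists ?L (Suc (Max (\<Union>(set ` X))))"
      using ns that by (auto simp: dec_lists_def A_def)
  qed
  have mono: "dec_lists ?L N \<subseteq> dec_lists ?L M" if "N \<le> M" for N M
    using that by (auto simp: dec_lists_def)
  have sub: "dec_lists ?L N \<subseteq> A" for N
    by (auto simp: dec_lists_def A_def)
  have "\<exists>C. \<forall>N. nested (map (\<lambda>f n. norm (f n)) ?fs) N \<le> C"
  proof -
    \<comment> \<open>The leading x gives a \<ge> 1, so only the outermost coefficient is claimed to
      decay like 1/n^2; the others get 1/n.\<close>
    have 1: "norm (phi lam a n) \<le> K / (real n)\<^sup>2" if "n \<ge> 1" for n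
    proof -
      have "norm (phi lam a n) \<le> K / real n ^ Suc a"
        by (rule phi_bound[OF K that])
      also have "\<dots> \<le> K / (real n)\<^sup>2"
        using K a that by (intro divide_left_mono power_increasing) auto
      finally show ?thesis .
    qed
    have 2: "norm (phi lam b n) \<le> K / n" if "n \<ge> 1" for n b
    proof -
      have "norm (phi lam b n) \<le> K / real n ^ Suc b"
        by (rule phi_bound[OF K that])
      also have "\<dots> \<le> K / (real n)^1"
        using K that by (intro divide_left_mono power_increasing) auto
      finally show ?thesis by simp
    qed
    show ?thesis
      unfolding a list.map by (rule nested_bounded[of _ K]) (use 1 2 in auto)
  qed
  then obtain C where C: "\<And>N. nested (map (\<lambda>f n. norm (f n)) ?fs) N \<le> C"
    by blast
  have "(\<lambda>ns. norm (f ns)) summable_on A"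
  proof (rule nonneg_bdd_above_summable_on)
    have "sum (\<lambda>ns. norm (f ns)) X \<le> C" if X: "finite X" "X \<subseteq> A" for X
    proof -
      obtain N where "X \<subseteq> dec_lists ?L N"
        using exh[OF X] by blast
      then have "sum (\<lambda>ns. norm (f ns)) X \<le> sum (\<lambda>ns. norm (f ns)) (dec_lists ?L N)"
        by (intro sum_mono2 finite_dec_lists) auto
      with C[of N] show ?thesis
        by (simp add: sum_norm_f)
    qed
    then show "bdd_above (sum (\<lambda>ns. norm (f ns)) ` {F. F \<subseteq> A \<and> finite F})"
      by (intro bdd_aboveI[of _ C]) auto
  qed auto
  then have "(f has_sum infsum f A) A"
    by (rule has_sum_infsum[OF abs_summable_summable])
  then have "(sum f \<longlongrightarrow> infsum f A) (finite_subsets_at_top A)"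
    by (simp add: has_sum_def)
  \<comment> \<open>The truncations increase and exhaust \<open>A\<close>, so they are cofinal among
    its finite subsets and their sums inherit the limit.\<close>
  moreover have "filterlim (\<lambda>N. dec_lists ?L N) (finite_subsets_at_top A) sequentially"
    unfolding filterlim_finite_subsets_at_top
  proof (intro allI impI)
    fix X assume "finite X \<and> X \<subseteq> A"
    then obtain N where "X \<subseteq> dec_lists ?L N"
      using exh by blast
    then show "\<forall>\<^sub>F N in sequentially. finite (dec_lists ?L N) \<and> X \<subseteq> dec_lists ?L N \<and> dec_lists ?L N \<subseteq> A"
      using mono sub by (intro eventually_sequentiallyI[of N]) (auto simp: finite_dec_lists)
  qed
  ultimately have "(\<lambda>N. sum f (dec_lists ?L N)) \<longlonglongrightarrow> infsum f A"
    by (rule filterlim_compose)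
  moreover have "infsum f A = Fword w lam"
    by (simp add: Fword_def Fsum_def A_def f_def[abs_def])
  moreover have "\<forall>\<^sub>F N in sequentially. sum f (dec_lists ?L N) = (\<Sum>n<N. word_op lam w delta0 n)"
    using eventually_ge_at_top[of 1]
  proof eventually_elim
    case (elim N)
    show ?case
      using nested_word_op[of w 0 N lam] assms(1,2) elim unfolding sum_f by simp
  qed
  ultimately show ?thesis
    using Lim_transform_eventually[of "\<lambda>N. sum f (dec_lists ?L N)" "infsum f A"] by simp
qed

text \<open>Decay of order \<open>n powr (- 1/2)\<close> is preserved by both letters, and avoids powers of logarithms.\<close>

definition sqrt_decay :: "(nat \<Rightarrow> complex) \<Rightarrow> bool" where
  "sqrt_decay h \<longleftrightarrow> (\<exists>C\<ge>0. \<forall>n\<ge>1. norm (h n) \<le> C / sqrt n)"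

lemma sqrt_decayI:
  fixes h :: "nat \<Rightarrow> complex"
  assumes "\<And>n. n \<ge> 1 \<Longrightarrow> norm (h n) \<le> C / sqrt n"
  shows "sqrt_decay h"
proof -
  have "norm (h 1) \<le> C / sqrt 1"
    using assms[of 1] by simp
  then have "C \<ge> 0"
    using norm_ge_zero[of "h 1"] by (simp del: norm_ge_zero)
  with assms show ?thesis
    by (auto simp: sqrt_decay_def)
qed

lemma sqrt_decay_delta0: "sqrt_decay delta0"
  by (rule sqrt_decayI[of _ 0]) (simp add: delta0_def)

lemma sqrt_decay_add:
  assumes "sqrt_decay f" "sqrt_decay g"
  shows "sqrt_decay (\<lambda>n. f n + g n)"
proof -
  obtain C D where "\<And>n. n \<ge> 1 \<Longrightarrow> norm (f n) \<le> C / sqrt n" "\<And>n. n \<ge> 1 \<Longrightarrow> norm (g n) \<le> D / sqrt n"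
    using assms by (auto simp: sqrt_decay_def)
  then show ?thesis
    by (intro sqrt_decayI[of _ "C + D"]) (metis add_divide_distrib norm_triangle_mono)
qed

lemma sqrt_decay_xop:
  assumes "sqrt_decay h"
  shows "sqrt_decay (xop h)"
proof -
  obtain C where C: "C \<ge> 0" "\<And>n. n \<ge> 1 \<Longrightarrow> norm (h n) \<le> C / sqrt n"
    using assms by (auto simp: sqrt_decay_def)
  show ?thesis
  proof (rule sqrt_decayI)
    fix n :: nat assume n: "n \<ge> 1"
    have "norm (xop h n) = norm (h n) / n"
      by (simp add: xop_def norm_divide)
    also have "\<dots> \<le> norm (h n) / 1"
      using n by (intro divide_left_mono) auto
    finally show "norm (xop h n) \<le> C / sqrt n"
      using C(2)[OF n] by simp
  qed
qed

text \<open>Partial sums of terms of order 1/sqrt p have order sqrt n, and the new pole supplies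
  1/n. The mass at 0 is absorbed by sqrt n \<ge> 1.\<close>

lemma sqrt_decay_yop:
  assumes "sqrt_decay h"
  shows "sqrt_decay (yop lam h)"
proof -
  obtain C where C: "C \<ge> 0" "\<And>n. n \<ge> 1 \<Longrightarrow> norm (h n) \<le> C / sqrt n"
    using assms by (auto simp: sqrt_decay_def)
  obtain K where K: "K > 0" "\<And>n. n \<ge> 1 \<Longrightarrow> norm (1 / (of_nat n - lam)) \<le> K / real n"
    using inverse_diff_bound by blast
  define D where "D = norm (h 0) + C * 2"
  show ?thesis
  proof (rule sqrt_decayI)
    fix n :: nat assume n: "n \<ge> 1"
    have "{..<n} = insert 0 {1..<n}"
      using n by auto
    then have "norm (\<Sum>p<n. h p) \<le> norm (h 0) + norm (\<Sum>p\<in>{1..<n}. h p)"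
      by (simp add: norm_triangle_ineq)
    also have "norm (\<Sum>p\<in>{1..<n}. h p) \<le> (\<Sum>p\<in>{1..<n}. C * (1 / sqrt p))"
      by (rule sum_norm_le) (use C(2) in auto)
    also have "\<dots> \<le> C * (2 * sqrt n)"
      unfolding sum_distrib_left[symmetric] by (intro mult_left_mono sum_inverse_sqrt_le C)
    also have "norm (h 0) \<le> norm (h 0) * sqrt n"
      using n by (simp add: mult_le_cancel_left1)
    finally have *: "norm (\<Sum>p<n. h p) \<le> D * sqrt n"
      by (simp add: D_def algebra_simps)
    have "norm (yop lam h n) = norm (\<Sum>p<n. h p) * norm (1 / (of_nat n - lam))"
      by (simp add: yop_def norm_divide)
    also have "\<dots> \<le> D * sqrt n * (K / n)"
      using C K n by (intro mult_mono * K) (auto simp: D_def)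
    also have "\<dots> = D * K / sqrt n"
      using n by (simp add: field_simps)
    finally show "norm (yop lam h n) \<le> D * K / sqrt n" .
  qed
qed

lemma sqrt_decay_xop_funpow: "sqrt_decay h \<Longrightarrow> sqrt_decay ((xop ^^ r) h)"
  by (induction r) (auto intro: sqrt_decay_xop)

lemma sqrt_decay_yop_funpow: "sqrt_decay h \<Longrightarrow> sqrt_decay ((yop lam ^^ r) h)"
  by (induction r) (auto intro: sqrt_decay_yop)

text \<open>\<open>ssum\<close> by itself need not decay; divided by n it is a y with pole at 0 plus
  the diagonal term.\<close>

lemma sqrt_decay_xop_ssum: "sqrt_decay h \<Longrightarrow> sqrt_decay (xop (ssum h))"
proof -
  assume h: "sqrt_decay h"
  have "xop (ssum h) = (\<lambda>n. yop 0 h n + xop h n)"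
    by (simp add: fun_eq_iff xop_def yop_def ssum_eq add_divide_distrib)
  then show ?thesis
    by (simp add: h sqrt_decay_add sqrt_decay_xop sqrt_decay_yop)
qed

lemma sqrt_decay_tendsto_0:
  assumes "sqrt_decay h"
  shows "h \<longlonglongrightarrow> 0"
proof -
  obtain C where C: "C \<ge> 0" "\<And>n. n \<ge> 1 \<Longrightarrow> norm (h n) \<le> C / sqrt n"
    using assms by (auto simp: sqrt_decay_def)
  have "(\<lambda>n. C / sqrt (real n)) \<longlonglongrightarrow> 0"
    by (intro tendsto_divide_0[OF tendsto_const] filterlim_at_top_imp_at_infinity
        filterlim_compose[OF sqrt_at_top filterlim_real_sequentially])
  then show ?thesis
    by (rule Lim_null_comparison[rotated]) (use C eventually_sequentially in blast)
qed

section \<open>Left side: collapsing the terms of one block\<close>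

definition core_op :: "complex \<Rightarrow> nat \<Rightarrow> nat \<Rightarrow> (nat \<Rightarrow> complex) \<Rightarrow> nat \<Rightarrow> complex" where
  "core_op lam k l h = (xop ^^ k) (ssum ((yop lam ^^ (l - 1)) h))"

lemma core_op_eq: "core_op lam k l h n = ssum ((yop lam ^^ (l - 1)) h) n / of_nat n ^ k"
  by (simp add: core_op_def xop_funpow)

lemma core_op_0: "k \<ge> 1 \<Longrightarrow> core_op lam k l h 0 = 0"
  by (simp add: core_op_eq)

lemma sqrt_decay_core_op:
  assumes "sqrt_decay h" "k \<ge> 1"
  shows "sqrt_decay (core_op lam k l h)"
proof -
  obtain k' where "k = Suc k'"
    using assms(2) by (cases k) auto
  then show ?thesis
    using assms(1)
    by (simp add: core_op_def funpow_swap1 sqrt_decay_xop_funpow sqrt_decay_xop_ssum sqrt_decay_yop_funpow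
        del: funpow.simps add: funpow_Suc_right)
qed

abbreviation weight :: "complex \<Rightarrow> nat \<times> nat \<Rightarrow> complex" where
  "weight lam e \<equiv> (- lam) ^ (1 - fst e - snd e)"

abbreviation lhs_block :: "nat \<Rightarrow> nat \<Rightarrow> nat \<times> nat \<Rightarrow> letter list" where
  "lhs_block k l e \<equiv> replicate (k - fst e) LX @ replicate (l - snd e) LY"

text \<open>The pairs (0,0) and (1,0) together carry -lam/n^k + 1/n^(k-1) = (n - lam)/n^k. This
  cancels the pole of the outermost y and leaves the sum over p < n, to which (0,1) adds p = n. At n
  = 0 everything vanishes.\<close>

lemma sum_lhs_block:
  assumes "k \<ge> 1" "l \<ge> 1" "\<forall>n::nat. n \<ge> 1 \<longrightarrow> lam \<noteq> of_nat n"
  shows "(\<Sum>e\<in>Ipairs. weight lam e * word_op lam (lhs_block k l e) h n) = core_op lam k l h n"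
proof -
  define g where "g = (yop lam ^^ (l - 1)) h"
  have "(yop lam ^^ l) h = yop lam g"
    using assms(2) by (cases l) (auto simp: g_def)
  moreover have "k = Suc (k - 1)"
    using assms(1) by simp
  moreover have "- lam * (yop lam g n / of_nat n ^ Suc (k - 1)) + yop lam g n / of_nat n ^ (k - 1) + g n / of_nat n ^ Suc (k - 1)
      = ssum g n / of_nat n ^ Suc (k - 1)"
  proof (cases "n = 0")
    case False
    with assms(3) have "of_nat n - lam \<noteq> 0"
      by (metis less_one linorder_not_less right_minus_eq)
    moreover have "- lam * (a / N ^ Suc r) + a / N ^ r + b / N ^ Suc r = (a * (N - lam) + b) / N ^ Suc r"
      if "N \<noteq> 0" for a b N :: complex and r
      using that by (simp add: field_simps)
    moreover have "ssum g n = yop lam g n * (of_nat n - lam) + g n"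
      using calculation by (simp add: yop_def ssum_eq)
    ultimately show ?thesis
      using False by (simp only:) simp
  qed simp
  ultimately show ?thesis
    unfolding core_op_eq Ipairs_def by (simp add: xop_funpow g_def algebra_simps)
qed

subsection \<open>The identity for f\<close>

abbreviation powi_weight :: "nat \<Rightarrow> complex \<Rightarrow> nat set \<Rightarrow> (nat \<Rightarrow> nat \<times> nat) \<Rightarrow> complex" where
  "powi_weight m lam J d \<equiv> (- lam) powi (int m - int (\<Sum>i\<in>J. fst (d i)) - int (\<Sum>i\<in>J. snd (d i)))"

lemma fst_snd_Ipairs: "e \<in> Ipairs \<Longrightarrow> fst e + snd e \<le> 1"
  by (auto simp: Ipairs_def)

text \<open>Pairs in \<open>Ipairs\<close> have component sum at most 1, so the truncated
  subtraction in \<open>weight\<close> is exact and the exponents add up.\<close>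

lemma prod_weight:
  assumes "finite J" "\<And>i. i \<in> J \<Longrightarrow> d i \<in> Ipairs"
  shows "(\<Prod>i\<in>J. weight lam (d i)) = powi_weight (card J) lam J d"
proof -
  have "int (\<Sum>i\<in>J. 1 - fst (d i) - snd (d i)) = (\<Sum>i\<in>J. 1 - int (fst (d i)) - int (snd (d i)))"
    using fst_snd_Ipairs[OF assms(2)] by (simp add: of_nat_diff algebra_simps)
  also have "\<dots> = int (card J) - int (\<Sum>i\<in>J. fst (d i)) - int (\<Sum>i\<in>J. snd (d i))"
    by (simp add: sum_subtractf)
  finally have exponent: "int (\<Sum>i\<in>J. 1 - fst (d i) - snd (d i)) = \<dots>" .
  have "(\<Prod>i\<in>J. weight lam (d i)) = (- lam) powi int (\<Sum>i\<in>J. 1 - fst (d i) - snd (d i))"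
    by (simp only: power_sum power_int_of_nat)
  then show ?thesis
    by (simp only: exponent)
qed

text \<open>On the right there are \<open>m + 1\<close> pairs, so the exponent can be -1.\<close>

lemma prod_weight_Suc:
  assumes "finite J" "\<And>i. i \<in> J \<Longrightarrow> d i \<in> Ipairs" "card J = Suc m" "lam \<noteq> 0"
  shows "powi_weight m lam J d = inverse (- lam) * (\<Prod>i\<in>J. weight lam (d i))"
proof -
  have "int m - a - b = (int (card J) - a - b) - 1" for a b
    using assms(3) by simp
  then have "powi_weight m lam J d =
      (- lam) powi ((int (card J) - int (\<Sum>i\<in>J. fst (d i)) - int (\<Sum>i\<in>J. snd (d i))) - 1)"
    by (simp only:)
  also have "\<dots> = powi_weight (card J) lam J d / (- lam) powi 1"
    using assms(4) by (intro power_int_diff) simp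
  also have "\<dots> = (\<Prod>i\<in>J. weight lam (d i)) / (- lam)"
    by (simp only: prod_weight[OF assms(1,2)] power_int_1_right)
  finally show ?thesis
    by (simp only: divide_inverse mult.commute[of "inverse (- lam)"])
qed

lemma fword_shape:
  assumes "m \<ge> 1" "k 1 \<ge> 1" "l m \<ge> 1"
  shows "fword m k l \<noteq> []" "hd (fword m k l) = LX" "last (fword m k l) = LY"
proof -
  have *: "replicate r a = a # replicate (r - 1) a" if "r \<ge> 1" for r and a :: letter
    using that by (cases r) auto
  have "fword m k l = LX # replicate (k 1 - 1) LX @ replicate (l 1) LY @
      concat (map (\<lambda>i. replicate (k i) LX @ replicate (l i) LY) [2..<m+1])"
    using assms *[of "k 1" LX] by (simp add: fword_def upt_conv_Cons numeral_2_eq_2 del: upt_Suc)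
  then show "fword m k l \<noteq> []" "hd (fword m k l) = LX"
    by auto
  have "fword m k l = concat (map (\<lambda>i. replicate (k i) LX @ replicate (l i) LY) [1..<m]) @
      replicate (k m) LX @ replicate (l m) LY"
    using assms by (simp add: fword_def)
  then show "last (fword m k l) = LY"
    using assms by simp
qed

text \<open>On the right, pair j shortens the y-run of block j - 1 and the x-run of block j. Cutting
  the word between the x-run and the y-run of each block makes every pair govern one contiguous
  piece.\<close>

lemma concat_regroup:
  assumes "s \<le> e"
  shows "b s @ concat (map (\<lambda>i. a i @ b (Suc i)) [s..<e]) @ a e = concat (map (\<lambda>j. b j @ a j) [s..<Suc e])"
  using assms
proof (induction e rule: dec_induct)
  case (step e)
  then show ?case by (simp add: append.assoc[symmetric] del: append.assoc append_assoc)
qed simp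

text \<open>P stands for k_1 = 1 and Q for l_m = 1. Removing the pairs that would empty the first
  x-run or the last y-run covers all four cases by one formula.\<close>

definition lhs_ix :: "nat \<Rightarrow> bool \<Rightarrow> bool \<Rightarrow> nat \<Rightarrow> (nat \<times> nat) set" where
  "lhs_ix m P Q i = Ipairs - (if P \<and> i = 1 then {(1,0)} else {}) - (if Q \<and> i = m then {(0,1)} else {})"

text \<open>Pair 1 has no y-run on its left and pair m + 1 no x-run on its right, so those
  components are removed as well.\<close>

definition rhs_ix :: "nat \<Rightarrow> bool \<Rightarrow> bool \<Rightarrow> nat \<Rightarrow> (nat \<times> nat) set" where
  "rhs_ix m P Q j = Ipairs - (if j = 1 then {(0,1)} else {}) - (if j = m + 1 then {(1,0)} else {})
     - (if P \<and> j = 1 then {(1,0)} else {}) - (if Q \<and> j = m + 1 then {(0,1)} else {})"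

lemma finite_Ipairs: "finite Ipairs"
  by (simp add: Ipairs_def)

lemma lhs_ix_subset: "lhs_ix m P Q i \<subseteq> Ipairs" and rhs_ix_subset: "rhs_ix m P Q i \<subseteq> Ipairs"
  by (auto simp: lhs_ix_def rhs_ix_def)

lemma finite_lhs_ix: "finite (lhs_ix m P Q i)" and finite_rhs_ix: "finite (rhs_ix m P Q i)"
  by (rule finite_subset[OF lhs_ix_subset finite_Ipairs], rule finite_subset[OF rhs_ix_subset finite_Ipairs])

text \<open>The data m = k_1 = l_1 = 1 are the only ones outside the four cases. Excluding them
  ensures that the two removals in \<open>lhs_ix\<close> never hit the same block.\<close>

locale block_data =
  fixes m :: nat and k l :: "nat \<Rightarrow> nat" and lam :: complex
  assumes m: "m \<ge> 1" and k: "\<And>i. 1 \<le> i \<Longrightarrow> i \<le> m \<Longrightarrow> k i \<ge> 1" and l: "\<And>i. 1 \<le> i \<Longrightarrow> i \<le> m \<Longrightarrow> l i \<ge> 1"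
    and nonpole: "\<forall>n::nat. n \<ge> 1 \<longrightarrow> lam \<noteq> of_nat n"
    and not_one: "\<not> (m = 1 \<and> k 1 = 1 \<and> l 1 = 1)"
begin

abbreviation P where "P \<equiv> k 1 = 1"
abbreviation Q where "Q \<equiv> l m = 1"
abbreviation mu where "mu \<equiv> lam - 1"

lemma k_pos: "1 \<le> i \<Longrightarrow> i \<le> m \<Longrightarrow> Suc 0 \<le> k i"
  using k by simp

lemma mu_nonpole: "of_nat n - mu \<noteq> 0"
proof -
  have "lam \<noteq> of_nat (Suc n)"
    using nonpole[rule_format, of "Suc n"] by simp
  then show ?thesis
    by (auto simp: algebra_simps)
qed

lemma mu_nonzero: "mu \<noteq> 0"
  using mu_nonpole[of 0] by simp

definition tail :: "nat \<Rightarrow> nat \<Rightarrow> complex" where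
  "tail i = foldr (\<lambda>i. core_op lam (k i) (l i)) [i..<m+1] delta0"

lemma tail_end: "tail (Suc m) = delta0"
  by (simp add: tail_def)

lemma tail_rec: "i \<le> m \<Longrightarrow> tail i = core_op lam (k i) (l i) (tail (Suc i))"
  by (simp add: tail_def upt_conv_Cons del: upt_Suc)

lemma tail_0: "1 \<le> i \<Longrightarrow> i \<le> m \<Longrightarrow> tail i 0 = 0"
  by (simp add: tail_rec core_op_0 k_pos)

lemma sqrt_decay_tail: 
  assumes "1 \<le> i" "i \<le> Suc m"
  shows "sqrt_decay (tail i)"
  using assms(2,1)
  by (induction i rule: inc_induct) (simp_all add: tail_end sqrt_decay_delta0 tail_rec sqrt_decay_core_op k_pos)

abbreviation lhs_op :: "nat \<Rightarrow> (nat \<Rightarrow> complex) \<Rightarrow> nat \<Rightarrow> complex" where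
  "lhs_op \<equiv> \<lambda>i h n. \<Sum>e\<in>lhs_ix m P Q i. weight lam e * word_op lam (lhs_block (k i) (l i) e) h n"

text \<open>When k_1 = 1, the removed pair (1,0) would have contributed the bare word y^(l_1), which
  is subtracted. The assumption on \<open>h\<close> records that block m acts directly on the unit
  mass.\<close>

lemma lhs_op_eq:
  assumes "1 \<le> i" "i \<le> m" "Q \<and> i = m \<Longrightarrow> h = delta0"
  shows "lhs_op i h n = core_op lam (k i) (l i) h n - (if P \<and> i = 1 then (yop lam ^^ l i) h n else 0)"
proof -
  let ?t = "\<lambda>e. weight lam e * word_op lam (lhs_block (k i) (l i) e) h n"
  note core = sum_lhs_block[OF k[OF assms(1,2)] l[OF assms(1,2)] nonpole, of h n]
  consider "P \<and> i = 1" "\<not> (Q \<and> i = m)" | "\<not> (P \<and> i = 1)" "Q \<and> i = m" | "\<not> (P \<and> i = 1)" "\<not> (Q \<and> i = m)"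
    using not_one by auto
  then show ?thesis
  proof cases
    case 1
    have "sum ?t (Ipairs - {(1,0)}) = sum ?t Ipairs - ?t (1,0)"
      by (simp add: sum_diff1 finite_Ipairs) (simp add: Ipairs_def)
    then show ?thesis
      using 1 core by (auto simp: lhs_ix_def)
  next
    case 2
    have "sum ?t (Ipairs - {(0,1)}) = sum ?t Ipairs - ?t (0,1)"
      by (simp add: sum_diff1 finite_Ipairs) (simp add: Ipairs_def)
    \<comment> \<open>The missing word ends in x, so it acts on the unit mass at 0, which x kills since \<open>1/0 = 0\<close>.\<close>
    moreover have "?t (0,1) = 0"
      using 2 assms k[of i] by (cases n) (auto simp: xop_funpow delta0_def)
    moreover have "lhs_ix m P Q i = Ipairs - {(0,1)}"
      using 2 unfolding lhs_ix_def by auto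
    ultimately show ?thesis
      using 2(1) core by auto
  next
    case 3
    then have "lhs_ix m P Q i = Ipairs"
      unfolding lhs_ix_def by auto
    then show ?thesis
      using 3(1) core by auto
  qed
qed

lemma lhs_fold:
  assumes "1 \<le> i" "i \<le> Suc m"
  shows "foldr lhs_op [i..<m+1] delta0 = (\<lambda>n. tail i n - (if P \<and> i = 1 then (yop lam ^^ l 1) (tail 2) n else 0))"
  using assms(2,1)
proof (induction i rule: inc_induct)
  case base
  then show ?case using m by (simp add: tail_end)
next
  case (step i)
  then have "foldr lhs_op [Suc i..<m+1] delta0 = tail (Suc i)"
    by (simp del: upt_Suc)
  then have "foldr lhs_op [i..<m+1] delta0 n = lhs_op i (tail (Suc i)) n" for n
    using step by (simp add: upt_conv_Cons del: upt_Suc)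
  moreover have "lhs_op i (tail (Suc i)) n = core_op lam (k i) (l i) (tail (Suc i)) n - (if P \<and> i = 1 then (yop lam ^^ l i) (tail (Suc i)) n else 0)" for n
    by (rule lhs_op_eq) (use step tail_end in auto)
  ultimately show ?case
    using step by (auto simp: tail_rec[of i] numeral_2_eq_2)
qed

section \<open>Right side: operators of the shifted pairs\<close>

abbreviation rhs_block :: "nat \<Rightarrow> nat \<times> nat \<Rightarrow> letter list" where
  "rhs_block j e \<equiv> (if j = 1 then [] else replicate (l (j - 1) - snd e) LY) @
                   (if j = m + 1 then [] else replicate (k j - fst e) LX)"

abbreviation rhs_op :: "nat \<Rightarrow> (nat \<Rightarrow> complex) \<Rightarrow> nat \<Rightarrow> complex" where
  "rhs_op \<equiv> \<lambda>j h n. \<Sum>e\<in>rhs_ix m P Q j. weight mu e * word_op mu (rhs_block j e) h n"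

text \<open>This is the collapsed tail from block j - 1 on with its leading x-run stripped, so it is
  indexed by the pair that completes it.\<close>

definition mid :: "nat \<Rightarrow> nat \<Rightarrow> complex" where
  "mid j = ssum ((yop lam ^^ (l (j - 1) - 1)) (tail j))"

lemma tail_mid: "1 \<le> i \<Longrightarrow> i \<le> m \<Longrightarrow> tail i n = mid (Suc i) n / of_nat n ^ k i"
  by (simp add: tail_rec[of i] core_op_eq mid_def)

text \<open>The two pairs combine to -mu y_mu \<open>delta0\<close> + \<open>delta0\<close> = -mu/(n
  - mu), valid also at n = 0 where both sides are 1; \<open>yop_shift\<close> carries this through
  the remaining y's. If l_m = 1 the pair (0,1) is absent: the density is 0 at n = 0 while the
  formula would give 1, hence the separate clause.\<close>

lemma rhs_op_end:
  shows "rhs_op (Suc m) delta0 0 = 0"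
    and "n > 0 \<Longrightarrow> rhs_op (Suc m) delta0 n = - mu * mid (Suc m) n / (of_nat n - mu)"
proof -
  have "rhs_op (Suc m) delta0 0 = 0 \<and> (n > 0 \<longrightarrow> rhs_op (Suc m) delta0 n = - mu * mid (Suc m) n / (of_nat n - mu))"
  proof (cases "l m = 1")
    case True
    have ix: "rhs_ix m P Q (Suc m) = {(0,0)}"
      using True m by (auto simp: rhs_ix_def Ipairs_def)
    have "yop mu delta0 n = 1 / (of_nat n - mu)" if "n > 0"
    proof -
      have "(\<Sum>p<n. delta0 p) = 1"
        using that by (simp add: delta0_def)
      then show ?thesis by (simp add: yop_def)
    qed
    then show ?thesis
      unfolding ix using True m by (auto simp: mid_def tail_end)
  next
    case False
    then have "l m \<ge> 2"
      using l[of m] m by auto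
    then obtain r where r: "l m = Suc (Suc r)"
      by (metis add_2_eq_Suc le_Suc_ex)
    have ix: "rhs_ix m P Q (Suc m) = {(0,0), (0,1)}"
      using False m by (auto simp: rhs_ix_def Ipairs_def)
    \<comment> \<open>The summand with coefficient 0 gives the right side the two-term shape of
      \<open>yop_funpow_lin\<close>.\<close>
    have "(\<lambda>n. - mu * yop mu delta0 n + 1 * delta0 n) = (\<lambda>n. - mu * (ssum delta0 n / (of_nat n - mu)) + 0 * delta0 n)"
    proof
      fix n
      show "- mu * yop mu delta0 n + 1 * delta0 n = - mu * (ssum delta0 n / (of_nat n - mu)) + 0 * delta0 n"
        using mu_nonzero by (cases "n = 0") (auto simp: yop_def delta0_def)
    qed
    then have "(yop mu ^^ Suc r) (\<lambda>n. - mu * yop mu delta0 n + 1 * delta0 n) =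
        (\<lambda>n. - mu * (ssum ((yop lam ^^ Suc r) delta0) n / (of_nat n - mu)) + 0 * (yop mu ^^ Suc r) delta0 n)"
      by (simp only: yop_funpow_lin yop_shift[OF refl])
    then have "- mu * (yop mu ^^ Suc r) (yop mu delta0) n + 1 * (yop mu ^^ Suc r) delta0 n =
        - mu * (ssum ((yop lam ^^ Suc r) delta0) n / (of_nat n - mu)) + 0 * (yop mu ^^ Suc r) delta0 n" for n
      unfolding yop_funpow_lin by (rule fun_cong)
    moreover have "rhs_op (Suc m) delta0 n = - mu * (yop mu ^^ Suc r) (yop mu delta0) n + 1 * (yop mu ^^ Suc r) delta0 n" for n
      unfolding ix using m by (simp add: r funpow_swap1)
    ultimately have "rhs_op (Suc m) delta0 n = - mu * mid (Suc m) n / (of_nat n - mu)" for n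
      by (simp add: mid_def tail_end r)
    moreover have "mid (Suc m) 0 = 0"
      by (simp add: mid_def r)
    ultimately show ?thesis
      by simp
  qed
  then show "rhs_op (Suc m) delta0 0 = 0"
    and "n > 0 \<Longrightarrow> rhs_op (Suc m) delta0 n = - mu * mid (Suc m) n / (of_nat n - mu)"
    by blast+
qed

text \<open>With l_(j-1) = r + 1, factor out y_mu^r. The pairs (0,0) and (1,0) give the sum of
  \<open>tail j\<close> over p < n, as 1 - mu/p cancels the pole of \<open>h\<close>; the pair (0,1)
  supplies p = n. \<open>yop_shift\<close> then moves the resulting \<open>ssum\<close> past the
  remaining y's.\<close>

lemma rhs_op_step:
  assumes "2 \<le> j" "j \<le> m" "h 0 = 0"
    and h: "\<And>n. n > 0 \<Longrightarrow> h n = - mu * mid (Suc j) n / (of_nat n - mu)"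
  shows "rhs_op j h n = - mu * mid j n / (of_nat n - mu)"
proof -
  have "l (j - 1) \<ge> 1"
    using assms by (intro l) auto
  then obtain r where r: "l (j - 1) = Suc r"
    by (cases "l (j - 1)") auto
  obtain s where s: "k j = Suc s"
    using k[of j] assms by (cases "k j") auto
  have ix: "rhs_ix m P Q j = Ipairs"
    using assms by (auto simp: rhs_ix_def)
  have "rhs_op j h n = - mu * (yop mu ^^ r) (yop mu ((xop ^^ Suc s) h)) n +
      1 * (1 * (yop mu ^^ r) ((xop ^^ Suc s) h) n + 1 * (yop mu ^^ r) (yop mu ((xop ^^ s) h)) n)"
    unfolding ix using assms by (simp add: Ipairs_def r[unfolded One_nat_def] s funpow_swap1)
  also have "\<dots> = (yop mu ^^ r) (\<lambda>n. - mu * yop mu ((xop ^^ Suc s) h) n +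
      1 * (1 * (xop ^^ Suc s) h n + 1 * yop mu ((xop ^^ s) h) n)) n"
    by (simp only: yop_funpow_lin)
  also have "(\<lambda>n. - mu * yop mu ((xop ^^ Suc s) h) n +
      1 * (1 * (xop ^^ Suc s) h n + 1 * yop mu ((xop ^^ s) h) n)) =
      (\<lambda>n. - mu * (ssum (tail j) n / (of_nat n - mu)) + 0 * h n)"
  proof
    fix n
    have pt: "(of_nat p - mu) * (h p / of_nat p ^ Suc s) = - mu * tail j p" for p
    proof (cases "p = 0")
      case False
      then show ?thesis
        using h[of p] mu_nonpole[of p] assms by (simp add: tail_mid s)
    qed (use assms tail_0[of j] in auto)
    have pt': "- mu * (h p / of_nat p ^ Suc s) + h p / of_nat p ^ s = - mu * tail j p" for p
    proof (cases "p = 0")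
      case False
      then have "- mu * (h p / of_nat p ^ Suc s) + h p / of_nat p ^ s = (of_nat p - mu) * (h p / of_nat p ^ Suc s)"
        by (simp add: field_simps)
      then show ?thesis using pt by simp
    qed (use assms tail_0[of j] in auto)
    have "- mu * yop mu ((xop ^^ Suc s) h) n + yop mu ((xop ^^ s) h) n =
        (\<Sum>p<n. - mu * (h p / of_nat p ^ Suc s) + h p / of_nat p ^ s) / (of_nat n - mu)"
      by (simp add: yop_def xop_funpow sum.distrib sum_distrib_left add_divide_distrib del: funpow.simps power_Suc mult_minus_left)
    also have "\<dots> = - mu * (\<Sum>p<n. tail j p) / (of_nat n - mu)"
      by (simp only: pt' sum_distrib_left)
    finally have A: "- mu * yop mu ((xop ^^ Suc s) h) n + yop mu ((xop ^^ s) h) n = - mu * (\<Sum>p<n. tail j p) / (of_nat n - mu)" .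
    have B: "(xop ^^ Suc s) h n = - mu * tail j n / (of_nat n - mu)"
      unfolding xop_funpow pt[symmetric] using mu_nonpole[of n] by simp
    show "- mu * yop mu ((xop ^^ Suc s) h) n +
      1 * (1 * (xop ^^ Suc s) h n + 1 * yop mu ((xop ^^ s) h) n) =
      - mu * (ssum (tail j) n / (of_nat n - mu)) + 0 * h n"
      using A B by (simp add: ssum_eq algebra_simps add_divide_distrib del: funpow.simps)
  qed
  also have "(yop mu ^^ r) \<dots> = (\<lambda>n. - mu * (ssum ((yop lam ^^ r) (tail j)) n / (of_nat n - mu)))"
    by (simp only: yop_funpow_lin yop_shift[OF refl]) simp
  finally show ?thesis
    by (simp add: mid_def r[unfolded One_nat_def])
qed

lemma mid_0: "2 \<le> j \<Longrightarrow> j \<le> m \<Longrightarrow> mid j 0 = 0"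
  by (simp add: mid_def yop_funpow_0 tail_0)

lemma rhs_fold:
  assumes "2 \<le> j" "j \<le> Suc m"
  shows "foldr rhs_op [j..<m+2] delta0 0 = 0 \<and>
    (\<forall>n>0. foldr rhs_op [j..<m+2] delta0 n = - mu * mid j n / (of_nat n - mu))"
  using assms(2,1)
proof (induction j rule: inc_induct)
  case base
  have "foldr rhs_op [Suc m..<m+2] delta0 = rhs_op (Suc m) delta0"
    by simp
  then show ?case
    unfolding add_2_eq_Suc' using rhs_op_end by presburger
next
  case (step j)
  define h where "h = foldr rhs_op [Suc j..<m+2] delta0"
  have "2 \<le> Suc j"
    using step by simp
  from step.IH[OF this]
  have h: "h 0 = 0" "\<And>n. n > 0 \<Longrightarrow> h n = - mu * mid (Suc j) n / (of_nat n - mu)"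
    unfolding h_def by blast+
  have "[j..<m+2] = j # [Suc j..<m+2]"
    using step by (simp add: upt_conv_Cons del: upt_Suc)
  then have "foldr rhs_op [j..<m+2] delta0 = rhs_op j h"
    by (simp add: h_def)
  then show ?case
    using rhs_op_step[OF _ _ h] mid_0[of j] step by simp
qed

text \<open>The first pair meets only an x-run. If k_1 \<ge> 2, its two terms cancel the pole n - mu
  and give \<open>tail 1\<close>. If k_1 = 1, the pair (0,0) stands alone and the pole survives as a
  correction, taken at \<open>Suc n\<close> because n - mu = (n + 1) - lam.\<close>

lemma rhs_density:
  "foldr rhs_op [1..<m+2] delta0 n =
    - mu * (tail 1 n - (if P then (yop lam ^^ l 1) (tail 2) (Suc n) else 0))"
proof -
  define h where "h = foldr rhs_op [2..<m+2] delta0"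
  have h: "h 0 = 0" "\<And>n. n > 0 \<Longrightarrow> h n = - mu * mid 2 n / (of_nat n - mu)"
    using rhs_fold[of 2] m by (auto simp: h_def)
  have "[1..<m+2] = 1 # [2..<m+2]"
    using m by (simp add: upt_conv_Cons numeral_2_eq_2 del: upt_Suc)
  then have dens: "foldr rhs_op [1..<m+2] delta0 n = rhs_op 1 h n"
    by (simp add: h_def)
  have tail1: "tail 1 n = mid 2 n / of_nat n ^ k 1"
    using tail_mid[of 1 n] m by (simp add: numeral_2_eq_2)
  show ?thesis
  proof (cases P)
    case True
    have ix: "rhs_ix m P Q 1 = {(0,0)}"
      using True m by (auto simp: rhs_ix_def Ipairs_def)
    have op: "rhs_op 1 h n = - mu * (h n / of_nat n)"
      unfolding ix using True m by (simp add: xop_def)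
    have "l 1 = Suc (l 1 - 1)"
      using l[of 1] m by simp
    then have "(yop lam ^^ l 1) (tail 2) (Suc n) = yop lam ((yop lam ^^ (l 1 - 1)) (tail 2)) (Suc n)"
      by (metis comp_apply funpow.simps(2))
    then have shift: "(yop lam ^^ l 1) (tail 2) (Suc n) = mid 2 n / (of_nat n - mu)"
      by (simp add: yop_def mid_def ssum_def lessThan_Suc_atMost algebra_simps)
    \<comment> \<open>Partial fractions of -mu/(n (n - mu)). At n = 0 this needs
      \<open>mid 2 0 = 0\<close>, which for m = 1 rests on l_1 \<ge> 2, the value l_1 = 1 being
      excluded.\<close>
    have h_div: "h n / of_nat n = mid 2 n / of_nat n - mid 2 n / (of_nat n - mu)"
    proof (cases "n = 0")
      case True
      have "mid 2 0 = 0"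
      proof (cases "m \<ge> 2")
        case False
        then have "m = 1" using m by simp
        then have "l 1 - 1 > 0"
          using not_one \<open>P\<close> l[of 1] by (cases "l 1") auto
        then show ?thesis
          by (simp add: mid_def yop_funpow_0)
      qed (simp add: mid_0)
      with True show ?thesis by simp
    next
      case False
      then show ?thesis
        using h(2)[of n] mu_nonpole[of n] by (simp add: divide_simps) (simp add: algebra_simps)
    qed
    have "foldr rhs_op [1..<m+2] delta0 n = - mu * (mid 2 n / of_nat n - mid 2 n / (of_nat n - mu))"
      unfolding dens op h_div ..
    also have "\<dots> = - mu * (tail 1 n - (if P then (yop lam ^^ l 1) (tail 2) (Suc n) else 0))"
      using True by (simp only: tail1 shift if_True power_one_right simp_thms)
    finally show ?thesis .
  next
    case False
    then have k1: "k 1 \<ge> 2"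
      using k[of 1] m by simp
    then obtain s where s: "k 1 = Suc s" "s > 0"
      by (cases "k 1") auto
    have ix: "rhs_ix m P Q 1 = {(0,0), (1,0)}"
      using False m by (auto simp: rhs_ix_def Ipairs_def)
    have "rhs_op 1 h n = - mu * (h n / of_nat n ^ Suc s) + h n / of_nat n ^ s"
      unfolding ix using m s(1)[unfolded One_nat_def] by (simp add: xop_funpow del: funpow.simps)
    also have "\<dots> = - mu * tail 1 n"
    proof (cases "n = 0")
      case True
      then show ?thesis using h(1) tail_0[of 1] m s(2) by simp
    next
      case False
      then have "- mu * (h n / of_nat n ^ Suc s) + h n / of_nat n ^ s = (of_nat n - mu) * h n / of_nat n ^ Suc s"
        by (simp add: field_simps)
      also have "(of_nat n - mu) * h n = - mu * mid 2 n"
        using False h(2)[of n] mu_nonpole[of n] by simp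
      finally show ?thesis
        by (simp only: tail1 s(1) times_divide_eq_right)
    qed
    finally have "foldr rhs_op [1..<m+2] delta0 n = - mu * tail 1 n"
      unfolding dens .
    then show ?thesis
      using False by (simp only: if_False simp_thms diff_zero)
  qed
qed

section \<open>Limits of the truncated sums and comparison of both sides\<close>

lemma lhs_tendsto:
  "(\<lambda>N. \<Sum>n<N. foldr lhs_op [1..<m+1] delta0 n) \<longlonglongrightarrow> lhs_sum ff m k l (lhs_ix m P Q) lam"
proof -
  let ?D = "PiE {1..m} (lhs_ix m P Q)"
  let ?w = "\<lambda>d. fword m (\<lambda>i. k i - fst (d i)) (\<lambda>i. l i - snd (d i))"
  have "(\<lambda>N. \<Sum>d\<in>?D. powi_weight m lam {1..m} d * (\<Sum>n<N. word_op lam (?w d) delta0 n))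
      \<longlonglongrightarrow> lhs_sum ff m k l (lhs_ix m P Q) lam"
    unfolding lhs_sum_def ff_def
  proof (intro tendsto_sum tendsto_mult tendsto_const Fword_tendsto)
    fix d assume d: "d \<in> ?D"
    then have "d 1 \<in> lhs_ix m P Q 1" "d m \<in> lhs_ix m P Q m"
      using m by auto
    \<comment> \<open>The index sets keep the first x-run and the last y-run nonempty, so each word
      has the shape required for convergence.\<close>
    then have "k 1 - fst (d 1) \<ge> 1" "l m - snd (d m) \<ge> 1"
      using k[of 1] l[of m] m by (auto simp: lhs_ix_def Ipairs_def split: if_splits)
    then show "?w d \<noteq> []" "hd (?w d) = LX" "last (?w d) = LY"
      using fword_shape m by auto
  qed
  moreover have "(\<Sum>d\<in>?D. powi_weight m lam {1..m} d * (\<Sum>n<N. word_op lam (?w d) delta0 n)) =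
      (\<Sum>n<N. foldr lhs_op [1..<m+1] delta0 n)" for N
  proof -
    have "powi_weight m lam {1..m} d = (\<Prod>i\<in>{1..<m+1}. weight lam (d i))" if "d \<in> ?D" for d
      using prod_weight[of "{1..m}" d lam] that lhs_ix_subset by (force simp: atLeastLessThanSuc_atLeastAtMost)
    then have "(\<Sum>d\<in>?D. powi_weight m lam {1..m} d * (\<Sum>n<N. word_op lam (?w d) delta0 n)) =
      (\<Sum>d\<in>?D. \<Sum>n<N. (\<Prod>i\<in>{1..<m+1}. weight lam (d i)) * word_op lam (?w d) delta0 n)"
      by (intro sum.cong refl) (simp only: sum_distrib_left)
    also have "\<dots> = (\<Sum>n<N. \<Sum>d\<in>?D. (\<Prod>i\<in>{1..<m+1}. weight lam (d i)) * word_op lam (?w d) delta0 n)"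
      by (rule sum.swap)
    also have "\<dots> = (\<Sum>n<N. foldr lhs_op [1..<m+1] delta0 n)"
      unfolding sum_PiE_word_op[where A = "lhs_ix m P Q", OF finite_lhs_ix, symmetric]
      by (simp add: fword_def atLeastLessThanSuc_atLeastAtMost del: upt_Suc)
    finally show ?thesis .
  qed
  ultimately show ?thesis by simp
qed

text \<open>There are m + 1 weights but the exponent starts from m; \<open>inverse (- mu)\<close>
  makes up for it and later cancels the factor -mu of \<open>rhs_density\<close>.\<close>

lemma rhs_tendsto:
  "(\<lambda>N. \<Sum>n<N. inverse (- mu) * foldr rhs_op [1..<m+2] delta0 n) \<longlonglongrightarrow> rhs_sum ff m k l (rhs_ix m P Q) lam"
proof -
  let ?D = "PiE {1..m+1} (rhs_ix m P Q)"
  let ?w = "\<lambda>d. fword m (\<lambda>i. k i - fst (d i)) (\<lambda>i. l i - snd (d (i + 1)))"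
  have "(\<lambda>N. \<Sum>d\<in>?D. powi_weight m mu {1..m+1} d * (\<Sum>n<N. word_op mu (?w d) delta0 n))
      \<longlonglongrightarrow> rhs_sum ff m k l (rhs_ix m P Q) lam"
    unfolding rhs_sum_def ff_def
  proof (intro tendsto_sum tendsto_mult tendsto_const Fword_tendsto)
    fix d assume d: "d \<in> ?D"
    then have "d 1 \<in> rhs_ix m P Q 1" "d (m + 1) \<in> rhs_ix m P Q (m + 1)"
      using m by auto
    then have "k 1 - fst (d 1) \<ge> 1" "l m - snd (d (m + 1)) \<ge> 1"
      using k[of 1] l[of m] m by (auto simp: rhs_ix_def Ipairs_def split: if_splits)
    then show "?w d \<noteq> []" "hd (?w d) = LX" "last (?w d) = LY"
      using fword_shape m by auto
  qed
  moreover have "(\<Sum>d\<in>?D. powi_weight m mu {1..m+1} d * (\<Sum>n<N. word_op mu (?w d) delta0 n)) =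
      (\<Sum>n<N. inverse (- mu) * foldr rhs_op [1..<m+2] delta0 n)" for N
  proof -
    have "powi_weight m mu {1..m+1} d = inverse (- mu) * (\<Prod>i\<in>{1..<m+2}. weight mu (d i))" if "d \<in> ?D" for d
    proof -
      have "{1..<m+2} = {1..m+1}"
        by auto
      moreover have "d i \<in> Ipairs" if "i \<in> {1..m+1}" for i
        using \<open>d \<in> ?D\<close> that rhs_ix_subset by blast
      ultimately show ?thesis
        using prod_weight_Suc[of "{1..m+1}" d m mu] mu_nonzero by simp
    qed
    moreover have "?w d = concat (map (\<lambda>j. rhs_block j (d j)) [1..<m+2])" for d
    proof -
      let ?a = "\<lambda>j. if j = m + 1 then [] else replicate (k j - fst (d j)) LX"
      let ?b = "\<lambda>j. if j = 1 then [] else replicate (l (j - 1) - snd (d j)) LY"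
      have "?w d = concat (map (\<lambda>i. ?a i @ ?b (Suc i)) [1..<m+1])"
        unfolding fword_def by (intro arg_cong[of _ _ concat] map_cong refl) auto
      also have "\<dots> = ?b 1 @ \<dots> @ ?a (m + 1)"
        by simp
      also have "\<dots> = concat (map (\<lambda>j. ?b j @ ?a j) [1..<Suc (m + 1)])"
        by (rule concat_regroup) simp
      finally show ?thesis by simp
    qed
    ultimately have "(\<Sum>d\<in>?D. powi_weight m mu {1..m+1} d * (\<Sum>n<N. word_op mu (?w d) delta0 n)) =
      (\<Sum>d\<in>?D. \<Sum>n<N. inverse (- mu) * ((\<Prod>i\<in>{1..<m+2}. weight mu (d i)) *
         word_op mu (concat (map (\<lambda>j. rhs_block j (d j)) [1..<m+2])) delta0 n))"
      by (intro sum.cong refl) (simp only: sum_distrib_left mult.assoc)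
    also have "\<dots> = (\<Sum>n<N. \<Sum>d\<in>?D. inverse (- mu) * ((\<Prod>i\<in>{1..<m+2}. weight mu (d i)) *
         word_op mu (concat (map (\<lambda>j. rhs_block j (d j)) [1..<m+2])) delta0 n))"
      by (rule sum.swap)
    also have "\<dots> = (\<Sum>n<N. inverse (- mu) * foldr rhs_op [1..<m+2] delta0 n)"
    proof -
      have "{1..m+1} = {1..<m+2}"
        by auto
      then show ?thesis
        unfolding sum_PiE_word_op[where A = "rhs_ix m P Q", OF finite_rhs_ix, symmetric]
        by (simp only: sum_distrib_left)
    qed
    finally show ?thesis .
  qed
  ultimately show ?thesis by simp
qed

lemma ff_identity: "lhs_sum ff m k l (lhs_ix m P Q) lam = rhs_sum ff m k l (rhs_ix m P Q) lam"
proof -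
  define E where "E n = (if P then (yop lam ^^ l 1) (tail 2) n else 0)" for n
  have E0: "E 0 = 0"
    using l[of 1] m by (simp add: E_def yop_funpow_0)
  have "E \<longlonglongrightarrow> 0"
  proof (cases P)
    case True
    then have "E = (yop lam ^^ l 1) (tail 2)"
      by (simp add: E_def[abs_def])
    then show ?thesis
      using m by (simp add: sqrt_decay_tendsto_0 sqrt_decay_yop_funpow sqrt_decay_tail)
  qed (simp add: E_def[abs_def])
  have "(\<lambda>N. \<Sum>n<N. tail 1 n - E n) \<longlonglongrightarrow> lhs_sum ff m k l (lhs_ix m P Q) lam"
    using lhs_tendsto lhs_fold[of 1] by (simp add: E_def)
  \<comment> \<open>Subtracting E N, which tends to 0, shifts the argument of E from n to n + 1
    throughout, because E 0 = 0.\<close>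
  then have "(\<lambda>N. (\<Sum>n<N. tail 1 n - E n) - E N) \<longlonglongrightarrow> lhs_sum ff m k l (lhs_ix m P Q) lam - 0"
    by (intro tendsto_diff \<open>E \<longlonglongrightarrow> 0\<close>)
  moreover have "(\<Sum>n<N. tail 1 n - E n) - E N = (\<Sum>n<N. tail 1 n - E (Suc n))" for N
    by (induction N) (simp_all add: E0)
  moreover have "(\<lambda>N. \<Sum>n<N. tail 1 n - E (Suc n)) \<longlonglongrightarrow> rhs_sum ff m k l (rhs_ix m P Q) lam"
  proof -
    have "inverse (- mu) * foldr rhs_op [1..<m+2] delta0 n = tail 1 n - E (Suc n)" for n
      unfolding rhs_density E_def using mu_nonzero by simp
    then show ?thesis
      using rhs_tendsto by (simp only:)
  qed
  ultimately show ?thesis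
    using LIMSEQ_unique by fastforce
qed

end

subsection \<open>Duality between f and g\<close>

lemma lhs_sum_cong:
  assumes "\<And>i. i \<in> {1..m} \<Longrightarrow> A i = B i"
  shows "lhs_sum h m k l A lam = lhs_sum h m k l B lam"
  using PiE_cong[of "{1..m}" A B] assms by (simp add: lhs_sum_def)

lemma rhs_sum_cong:
  assumes "\<And>j. j \<in> {1..m+1} \<Longrightarrow> A j = B j"
  shows "rhs_sum h m k l A lam = rhs_sum h m k l B lam"
  using PiE_cong[of "{1..m+1}" A B] assms by (simp add: rhs_sum_def)

lemma fword_cong:
  assumes "\<And>i. i \<in> {1..m} \<Longrightarrow> k i = k' i" "\<And>i. i \<in> {1..m} \<Longrightarrow> l i = l' i"
  shows "fword m k l = fword m k' l'"
  unfolding fword_def using assms by (intro arg_cong[of _ _ concat] map_cong refl) auto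

lemma gword_eq_fword: "gword m k l = fword m (\<lambda>i. l (m + 1 - i)) (\<lambda>i. k (m + 1 - i))"
proof -
  have "rev [1..<m+1] = map (\<lambda>i. m + 1 - i) [1..<m+1]"
    by (rule nth_equalityI) (simp_all add: rev_nth del: upt_Suc)
  then show ?thesis
    by (simp add: gword_def fword_def comp_def del: upt_Suc)
qed

text \<open>Restricting to \<open>{1..n}\<close> keeps the result extensional, so that flipping
  twice returns every member of a \<open>PiE\<close>.\<close>

definition flip :: "nat \<Rightarrow> (nat \<Rightarrow> nat \<times> nat) \<Rightarrow> nat \<Rightarrow> nat \<times> nat" where
  "flip n d = (\<lambda>i\<in>{1..n}. prod.swap (d (n + 1 - i)))"

lemma flip_in_PiE: "d \<in> PiE {1..n} A \<Longrightarrow> flip n d \<in> PiE {1..n} (\<lambda>i. prod.swap ` A (n + 1 - i))"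
proof (rule PiE_I)
  fix i assume d: "d \<in> PiE {1..n} A" and i: "i \<in> {1..n}"
  then have "n + 1 - i \<in> {1..n}"
    by auto
  with d have "d (n + 1 - i) \<in> A (n + 1 - i)"
    by (rule PiE_mem)
  then show "flip n d i \<in> prod.swap ` A (n + 1 - i)"
    using i by (simp add: flip_def)
qed (auto simp: flip_def)

lemma flip_flip: "d \<in> PiE {1..n} A \<Longrightarrow> flip n (flip n d) = d"
  by (auto simp: flip_def fun_eq_iff PiE_def extensional_def)

lemma sum_fst_flip: "(\<Sum>i\<in>{1..n}. fst (flip n d i)) = (\<Sum>i\<in>{1..n}. snd (d i))"
  and sum_snd_flip: "(\<Sum>i\<in>{1..n}. snd (flip n d i)) = (\<Sum>i\<in>{1..n}. fst (d i))"
  using sum.atLeastAtMost_rev[of "\<lambda>i. snd (d i)" 1 n] sum.atLeastAtMost_rev[of "\<lambda>i. fst (d i)" 1 n]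
  by (simp_all add: flip_def)

lemma sum_PiE_flip:
  "sum g (PiE {1..n} (\<lambda>i. prod.swap ` A (n + 1 - i))) = (\<Sum>d\<in>PiE {1..n} A. g (flip n d))"
proof (rule sum.reindex_bij_witness[where i = "flip n" and j = "flip n"])
  fix d assume d: "d \<in> PiE {1..n} (\<lambda>i. prod.swap ` A (n + 1 - i))"
  have "PiE {1..n} (\<lambda>i. prod.swap ` prod.swap ` A (n + 1 - (n + 1 - i))) = PiE {1..n} A"
    by (rule PiE_cong) (simp add: image_image)
  then show "flip n d \<in> PiE {1..n} A"
    using flip_in_PiE[OF d] by simp
qed (simp_all only: flip_flip flip_in_PiE)

lemma lhs_sum_gg:
  "lhs_sum gg m k l A lam =
   lhs_sum ff m (\<lambda>i. l (m + 1 - i)) (\<lambda>i. k (m + 1 - i)) (\<lambda>i. prod.swap ` A (m + 1 - i)) lam"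
  unfolding lhs_sum_def sum_PiE_flip sum_fst_flip sum_snd_flip
proof (intro sum.cong refl arg_cong2[of _ _ _ _ "(*)"])
  fix d
  show "powi_weight m lam {1..m} d =
      (- lam) powi (int m - int (\<Sum>i\<in>{1..m}. snd (d i)) - int (\<Sum>i\<in>{1..m}. fst (d i)))"
    by (simp add: algebra_simps)
  show "gg m (\<lambda>i. k i - fst (d i)) (\<lambda>i. l i - snd (d i)) lam =
      ff m (\<lambda>i. l (m + 1 - i) - fst (flip m d i)) (\<lambda>i. k (m + 1 - i) - snd (flip m d i)) lam"
    unfolding gg_def ff_def gword_eq_fword
    by (intro arg_cong2[of _ _ _ _ Fword] refl fword_cong) (auto simp: flip_def)
qed

text \<open>Blocks reverse by i to m + 1 - i but pairs by j to m + 2 - j. This offset of one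
  exchanges pair i, attached to k_i, with pair i + 1, attached to l_i, so the shifted form is
  preserved.\<close>

lemma rhs_sum_gg:
  "rhs_sum gg m k l B lam =
   rhs_sum ff m (\<lambda>i. l (m + 1 - i)) (\<lambda>i. k (m + 1 - i)) (\<lambda>j. prod.swap ` B (m + 1 + 1 - j)) lam"
  unfolding rhs_sum_def sum_PiE_flip sum_fst_flip sum_snd_flip
proof (intro sum.cong refl arg_cong2[of _ _ _ _ "(*)"])
  fix d
  show "powi_weight m (lam - 1) {1..m+1} d =
      (- (lam - 1)) powi (int m - int (\<Sum>i\<in>{1..m+1}. snd (d i)) - int (\<Sum>i\<in>{1..m+1}. fst (d i)))"
    by (simp add: algebra_simps)
  show "gg m (\<lambda>i. k i - fst (d i)) (\<lambda>i. l i - snd (d (i + 1))) (lam - 1) =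
      ff m (\<lambda>i. l (m + 1 - i) - fst (flip (m + 1) d i)) (\<lambda>i. k (m + 1 - i) - snd (flip (m + 1) d (i + 1))) (lam - 1)"
    unfolding gg_def ff_def gword_eq_fword
    by (intro arg_cong2[of _ _ _ _ Fword] refl fword_cong) (auto simp: flip_def Suc_diff_le)
qed

lemma swap_image_eq: "prod.swap ` S = {(a, b). (b, a) \<in> S}"
  by force

lemma swap_lhs_ix:
  assumes "i \<in> {1..m}"
  shows "prod.swap ` lhs_ix m P Q (m + 1 - i) = lhs_ix m Q P i"
proof -
  have "m + 1 - i = 1 \<longleftrightarrow> i = m" "m + 1 - i = m \<longleftrightarrow> i = 1"
    using assms by auto
  then show ?thesis
    unfolding lhs_ix_def Ipairs_def swap_image_eq by auto
qed

lemma swap_rhs_ix: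
  assumes "j \<in> {1..m+1}"
  shows "prod.swap ` rhs_ix m P Q (m + 1 + 1 - j) = rhs_ix m Q P j"
proof -
  have "m + 1 + 1 - j = 1 \<longleftrightarrow> j = m + 1" "m + 1 + 1 - j = m + 1 \<longleftrightarrow> j = 1"
    using assms by auto
  then show ?thesis
    unfolding rhs_ix_def Ipairs_def swap_image_eq by auto
qed

lemma (in block_data) gg_identity:
  "lhs_sum gg m k l (lhs_ix m P Q) lam = rhs_sum gg m k l (rhs_ix m P Q) lam"
proof -
  interpret dual: block_data m "\<lambda>i. l (m + 1 - i)" "\<lambda>i. k (m + 1 - i)" lam
  proof
    show "\<not> (m = 1 \<and> l (m + 1 - 1) = 1 \<and> k (m + 1 - 1) = 1)"
      using not_one by auto
  qed (use m k l nonpole in auto)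
  have "lhs_sum gg m k l (lhs_ix m P Q) lam =
      lhs_sum ff m (\<lambda>i. l (m + 1 - i)) (\<lambda>i. k (m + 1 - i)) (lhs_ix m Q P) lam"
    unfolding lhs_sum_gg by (rule lhs_sum_cong) (rule swap_lhs_ix)
  also have "\<dots> = rhs_sum ff m (\<lambda>i. l (m + 1 - i)) (\<lambda>i. k (m + 1 - i)) (rhs_ix m Q P) lam"
    using dual.ff_identity by simp
  also have "\<dots> = rhs_sum gg m k l (rhs_ix m P Q) lam"
    unfolding rhs_sum_gg by (rule rhs_sum_cong) (rule swap_rhs_ix[symmetric])
  finally show ?thesis .
qed

theorem theorem3p1:
  fixes m :: nat and k l :: "nat \<Rightarrow> nat" and lam :: complex
  assumes "m \<ge> 1"
    and "\<forall>i\<in>{1..m}. k i \<ge> 1 \<and> l i \<ge> 1"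
    and "\<forall>n::nat. n \<ge> 1 \<longrightarrow> lam \<noteq> of_nat n"
  shows "\<forall>h \<in> {ff, gg}.
    (k 1 \<noteq> 1 \<and> l m \<noteq> 1 \<longrightarrow>
       lhs_sum h m k l (\<lambda>i. Ipairs) lam
     = rhs_sum h m k l (\<lambda>j. if j = 1 then {(0,0),(1,0)} else if j = m + 1 then {(0,0),(0,1)} else Ipairs) lam)
  \<and> (k 1 = 1 \<and> l m \<noteq> 1 \<longrightarrow>
       lhs_sum h m k l (\<lambda>i. if i = 1 then {(0,0),(0,1)} else Ipairs) lam
     = rhs_sum h m k l (\<lambda>j. if j = 1 then {(0,0)} else if j = m + 1 then {(0,0),(0,1)} else Ipairs) lam)
  \<and> (k 1 \<noteq> 1 \<and> l m = 1 \<longrightarrow>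
       lhs_sum h m k l (\<lambda>i. if i = m then {(0,0),(1,0)} else Ipairs) lam
     = rhs_sum h m k l (\<lambda>j. if j = 1 then {(0,0),(1,0)} else if j = m + 1 then {(0,0)} else Ipairs) lam)
  \<and> (k 1 = 1 \<and> l m = 1 \<and> m \<ge> 2 \<longrightarrow>
       lhs_sum h m k l (\<lambda>i. if i = 1 then {(0,0),(0,1)} else if i = m then {(0,0),(1,0)} else Ipairs) lam
     = rhs_sum h m k l (\<lambda>j. if j = 1 then {(0,0)} else if j = m + 1 then {(0,0)} else Ipairs) lam)"
proof
  fix h assume "h \<in> {ff, gg}"
  \<comment> \<open>The explicit index families of the four cases need to match
    \<open>lhs_ix\<close> and \<open>rhs_ix\<close> only on the ranges over which the sums
    run.\<close>
  have identity: "lhs_sum h m k l A lam = rhs_sum h m k l B lam"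
    if not_one: "\<not> (m = 1 \<and> k 1 = 1 \<and> l m = 1)"
      and A: "\<And>i. i \<in> {1..m} \<Longrightarrow> A i = lhs_ix m (k 1 = 1) (l m = 1) i"
      and B: "\<And>j. j \<in> {1..m+1} \<Longrightarrow> B j = rhs_ix m (k 1 = 1) (l m = 1) j" for A B
  proof -
    interpret block_data m k l lam
    proof
      show "\<not> (m = 1 \<and> k 1 = 1 \<and> l 1 = 1)"
        using not_one by auto
    qed (use assms in auto)
    show ?thesis
      using \<open>h \<in> {ff, gg}\<close> ff_identity gg_identity lhs_sum_cong[of m A _, OF A] rhs_sum_cong[of m B _, OF B]
      by auto
  qed
  have "m + 1 \<noteq> 1"
    using assms(1) by simp
  then show "(k 1 \<noteq> 1 \<and> l m \<noteq> 1 \<longrightarrow>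
       lhs_sum h m k l (\<lambda>i. Ipairs) lam
     = rhs_sum h m k l (\<lambda>j. if j = 1 then {(0,0),(1,0)} else if j = m + 1 then {(0,0),(0,1)} else Ipairs) lam)
  \<and> (k 1 = 1 \<and> l m \<noteq> 1 \<longrightarrow>
       lhs_sum h m k l (\<lambda>i. if i = 1 then {(0,0),(0,1)} else Ipairs) lam
     = rhs_sum h m k l (\<lambda>j. if j = 1 then {(0,0)} else if j = m + 1 then {(0,0),(0,1)} else Ipairs) lam)
  \<and> (k 1 \<noteq> 1 \<and> l m = 1 \<longrightarrow>
       lhs_sum h m k l (\<lambda>i. if i = m then {(0,0),(1,0)} else Ipairs) lam
     = rhs_sum h m k l (\<lambda>j. if j = 1 then {(0,0),(1,0)} else if j = m + 1 then {(0,0)} else Ipairs) lam)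
  \<and> (k 1 = 1 \<and> l m = 1 \<and> m \<ge> 2 \<longrightarrow>
       lhs_sum h m k l (\<lambda>i. if i = 1 then {(0,0),(0,1)} else if i = m then {(0,0),(1,0)} else Ipairs) lam
     = rhs_sum h m k l (\<lambda>j. if j = 1 then {(0,0)} else if j = m + 1 then {(0,0)} else Ipairs) lam)"
    by (intro conjI impI; elim conjE; intro identity) (auto simp: lhs_ix_def rhs_ix_def Ipairs_def)
qed

end
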